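(* Let $\mathfrak n_{5,6}$ be the Lie algebra over $\mathbb F$ with ordered basis $\{x_1,x_2,x_3,x_4,x_5\}$ whose only nonzero brackets of basis elements (up to skew-symmetry) are $[x_4,x_3]=-x_1$, $[x_5,x_2]=-x_1$, $[x_5,x_3]=-x_2$, and $[x_5,x_4]=-x_3$. Then for all $j,k,l,m,n,p,q,r,s,t\in\mathbb Z_{\ge0}$ the following identity holds in $\mathbf U(\mathfrak n_{5,6})$: $$\begin{aligned} &(x_1^jx_2^kx_3^lx_4^mx_5^n)(x_1^px_2^qx_3^rx_4^sx_5^t)\\ &=\sum_{\alpha=0}^{\min\{n,q\}}\ \sum_{\substack{\beta_1,\beta_2\in\mathbb Z_{\ge0}\\ \beta_1+\beta_2\leq r\\ \beta_1+2\beta_2\leq n-\alpha}}\ \sum_{\substack{\gamma_1,\gamma_2,\gamma_3,\gamma_4\in\mathbb Z_{\ge0}\\ \gamma_1+\gamma_2+\gamma_3+2\gamma_4\le s\\ \gamma_1+2\gamma_2+3\gamma_3+\gamma_4\le n-\alpha-\beta_1-2\beta_2}}\ \sum_{\delta=0}^{\min\{m,r-\beta_1-\beta_2+\gamma_1\}}\binom{n}{\alpha}\binom{q}{\alpha}\binom{r}{\beta_1+\beta_2}\binom{n-\alpha}{\beta_1+2\beta_2}\\ &\quad\times \binom{\beta_1+\beta_2}{\beta_1}\binom{s}{\gamma_1+\gamma_2+\gamma_3+2\gamma_4}\binom{n-\alpha-\beta_1-2\beta_2}{\gamma_1+2\gamma_2+3\gamma_3+\gamma_4}\binom{m}{\delta}\binom{r-\beta_1-\beta_2+\gamma_1}{\delta}\alpha!\,\frac{(\beta_1+2\beta_2)!}{2^{\beta_2}}\\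 &\quad\times \frac{(\gamma_1+\gamma_2+\gamma_3+2\gamma_4)!\,(\gamma_1+2\gamma_2+3\gamma_3+\gamma_4)!}{(2!)^{\gamma_2+\gamma_4}(3!)^{\gamma_3}\gamma_4!\,\gamma_3!\,\gamma_2!\,\gamma_1!}\,\delta!\,(-1)^{\alpha+\beta_1+\gamma_1+\gamma_3+\delta}\\ &\quad\times x_1^{j+p+\alpha+\beta_2+\gamma_4+\gamma_3+\delta}x_2^{k+q-\alpha+\beta_1+\gamma_2}x_3^{l+r-\beta_1-\beta_2+\gamma_1-\delta}x_4^{m+s-\delta-\gamma_1-\gamma_2-\gamma_3-2\gamma_4}x_5^{n+t-\alpha-\beta_1-2\beta_2-\gamma_1-2\gamma_2-3\gamma_3-\gamma_4}. \end{aligned}$$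
   Context: $\mathbb F$ is $\mathbb R$ or $\mathbb C$. $\mathbf U(L)$ denotes the universal enveloping algebra of the Lie algebra $L$ (the universal unital associative $\mathbb F$-algebra with a linear map $\iota:L\to\mathbf U(L)$ satisfying $\iota([x,y])=\iota(x)\iota(y)-\iota(y)\iota(x)$). Elements of $L$ are identified with their images under $\iota$, so $xy=yx+[x,y]$ in $\mathbf U(L)$ for $x,y\in L$; powers and products of the $x_i$ are taken in $\mathbf U(L)$. *)

theory Defs
  imports
    Complex_Main
    "HOL-Library.Poly_Mapping"
    "HOL-Library.Product_Plus"
    "HOL-Algebra.QuotRing"
    "HOL-Algebra.Module"
begin

section \<open>The ground field\<close>

text \<open>Fields that are, up to a field isomorphism, the field of real or the field of complex
  numbers.\<close>

class real_or_complex = field_char_0 +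
  assumes real_or_complex:
    "(\<exists>h :: 'a \<Rightarrow> real. bij h \<and> (\<forall>a b. h (a + b) = h a + h b) \<and> (\<forall>a b. h (a * b) = h a * h b)) \<or>
     (\<exists>h :: 'a \<Rightarrow> complex. bij h \<and> (\<forall>a b. h (a + b) = h a + h b) \<and> (\<forall>a b. h (a * b) = h a * h b))"

instance real :: real_or_complex
  by standard (rule disjI1, rule exI[of _ "\<lambda>x. x"], simp add: bij_def inj_on_def surj_def)

instance complex :: real_or_complex
  by standard (rule disjI2, rule exI[of _ "\<lambda>x. x"], simp add: bij_def inj_on_def surj_def)


section \<open>Lie algebras\<close>

locale lie_algebra = vector_space scale
  for scale :: "'f::field \<Rightarrow> 'l::ab_group_add \<Rightarrow> 'l" +
  fixes brk :: "'l \<Rightarrow> 'l \<Rightarrow> 'l"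
  assumes brk_add_left: "brk (x + y) z = brk x z + brk y z"
    and brk_add_right: "brk x (y + z) = brk x y + brk x z"
    and brk_scale_left: "brk (scale c x) y = scale c (brk x y)"
    and brk_scale_right: "brk x (scale c y) = scale c (brk x y)"
    and brk_self: "brk x x = 0"
    and jacobi: "brk x (brk y z) + brk y (brk z x) + brk z (brk x y) = 0"

locale lie_algebra_n56 = lie_algebra scale brk
  for scale :: "'f::field \<Rightarrow> 'l::ab_group_add \<Rightarrow> 'l" and brk :: "'l \<Rightarrow> 'l \<Rightarrow> 'l" +
  fixes x1 x2 x3 x4 x5 :: 'l
  assumes basis_distinct: "distinct [x1, x2, x3, x4, x5]"
    and basis_independent: "independent {x1, x2, x3, x4, x5}"
    and basis_span: "span {x1, x2, x3, x4, x5} = UNIV"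
    and brk_43: "brk x4 x3 = - x1"
    and brk_52: "brk x5 x2 = - x1"
    and brk_53: "brk x5 x3 = - x2"
    and brk_54: "brk x5 x4 = - x3"
    and brk_21: "brk x2 x1 = 0"
    and brk_31: "brk x3 x1 = 0"
    and brk_41: "brk x4 x1 = 0"
    and brk_51: "brk x5 x1 = 0"
    and brk_32: "brk x3 x2 = 0"
    and brk_42: "brk x4 x2 = 0"


section \<open>Unital associative algebras\<close>

text \<open>The locale \<^locale>\<open>algebra\<close> of the library requires commutative multiplication.\<close>

locale assoc_algebra = ring A
  for A :: "('f::field, 'a, 'm) module_scheme" (structure) +
  assumes smult_closed: "x \<in> carrier A \<Longrightarrow> c \<odot> x \<in> carrier A"
    and smult_add_left: "x \<in> carrier A \<Longrightarrow> (c + d) \<odot> x = c \<odot> x \<oplus> d \<odot> x"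
    and smult_add_right: "x \<in> carrier A \<Longrightarrow> y \<in> carrier A \<Longrightarrow> c \<odot> (x \<oplus> y) = c \<odot> x \<oplus> c \<odot> y"
    and smult_smult: "x \<in> carrier A \<Longrightarrow> c \<odot> (d \<odot> x) = (c * d) \<odot> x"
    and smult_1: "x \<in> carrier A \<Longrightarrow> 1 \<odot> x = x"
    and smult_mult_left: "x \<in> carrier A \<Longrightarrow> y \<in> carrier A \<Longrightarrow> (c \<odot> x) \<otimes> y = c \<odot> (x \<otimes> y)"
    and smult_mult_right: "x \<in> carrier A \<Longrightarrow> y \<in> carrier A \<Longrightarrow> x \<otimes> (c \<odot> y) = c \<odot> (x \<otimes> y)"

definition algebra_hom ::
    "('f::field, 'a, 'm) module_scheme \<Rightarrow> ('f, 'b, 'n) module_scheme \<Rightarrow> ('a \<Rightarrow> 'b) set" where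
  "algebra_hom A B =
     {f \<in> ring_hom A B. \<forall>c. \<forall>x\<in>carrier A. f (c \<odot>\<^bsub>A\<^esub> x) = c \<odot>\<^bsub>B\<^esub> f x}"

definition lie_map ::
    "('f::field \<Rightarrow> 'l::ab_group_add \<Rightarrow> 'l) \<Rightarrow> ('l \<Rightarrow> 'l \<Rightarrow> 'l) \<Rightarrow> ('f, 'a, 'm) module_scheme \<Rightarrow> ('l \<Rightarrow> 'a) set" where
  "lie_map scale brk A =
     {\<phi>. (\<forall>x. \<phi> x \<in> carrier A) \<and>
         (\<forall>x y. \<phi> (x + y) = \<phi> x \<oplus>\<^bsub>A\<^esub> \<phi> y) \<and>
         (\<forall>c x. \<phi> (scale c x) = c \<odot>\<^bsub>A\<^esub> \<phi> x) \<and>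
         (\<forall>x y. \<phi> (brk x y) = \<phi> x \<otimes>\<^bsub>A\<^esub> \<phi> y \<ominus>\<^bsub>A\<^esub> \<phi> y \<otimes>\<^bsub>A\<^esub> \<phi> x)}"


section \<open>The universal enveloping algebra\<close>

text \<open>Lists under concatenation are the free monoid, so that the convolution product on
  \<^typ>\<open>'l list \<Rightarrow>\<^sub>0 'f\<close> makes this type the free unital associative algebra on the
  set \<^typ>\<open>'l\<close>.\<close>

instantiation list :: (type) monoid_add
begin
definition zero_list_def: "0 = []"
definition plus_list_def: "u + v = u @ v"
instance by standard (auto simp: zero_list_def plus_list_def)
end

definition free_assoc_algebra :: "('f::field, 'l list \<Rightarrow>\<^sub>0 'f) module" where
  "free_assoc_algebra =
     \<lparr>carrier = UNIV, mult = (*), one = 1, zero = 0, add = (+),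
      smult = (\<lambda>c p. Poly_Mapping.single [] c * p)\<rparr>"

definition gen :: "'l \<Rightarrow> ('l list \<Rightarrow>\<^sub>0 'f::field)" where
  "gen x = Poly_Mapping.single [x] 1"

text \<open>The generators are indexed by all elements of the Lie algebra, not by a basis: the first
  two families of relations make \<^const>\<open>gen\<close> linear (the quotient by them is the tensor
  algebra), the third turns the bracket into the commutator.\<close>

definition uea_relations ::
    "('f::field \<Rightarrow> 'l::ab_group_add \<Rightarrow> 'l) \<Rightarrow> ('l \<Rightarrow> 'l \<Rightarrow> 'l) \<Rightarrow> ('l list \<Rightarrow>\<^sub>0 'f) set" where
  "uea_relations scale brk =
     {gen (x + y) - (gen x + gen y) | x y. True} \<union>
     {gen (scale c x) - Poly_Mapping.single [] c * gen x | c x. True} \<union>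
     {gen (brk x y) - (gen x * gen y - gen y * gen x) | x y. True}"

definition uea_ideal ::
    "('f::field \<Rightarrow> 'l::ab_group_add \<Rightarrow> 'l) \<Rightarrow> ('l \<Rightarrow> 'l \<Rightarrow> 'l) \<Rightarrow> ('l list \<Rightarrow>\<^sub>0 'f) set" where
  "uea_ideal scale brk = Idl\<^bsub>free_assoc_algebra\<^esub> (uea_relations scale brk)"

definition uea ::
    "('f::field \<Rightarrow> 'l::ab_group_add \<Rightarrow> 'l) \<Rightarrow> ('l \<Rightarrow> 'l \<Rightarrow> 'l) \<Rightarrow> ('f, ('l list \<Rightarrow>\<^sub>0 'f) set) module" where
  "uea scale brk =
     (let T = free_assoc_algebra; I = uea_ideal scale brk; Q = T Quot I
      in \<lparr>carrier = carrier Q, mult = mult Q, one = one Q, zero = zero Q, add = add Q,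
          smult = (\<lambda>c X. \<Union>p\<in>X. I +>\<^bsub>T\<^esub> (c \<odot>\<^bsub>T\<^esub> p))\<rparr>)"

definition uea_incl ::
    "('f::field \<Rightarrow> 'l::ab_group_add \<Rightarrow> 'l) \<Rightarrow> ('l \<Rightarrow> 'l \<Rightarrow> 'l) \<Rightarrow> 'l \<Rightarrow> ('l list \<Rightarrow>\<^sub>0 'f) set" where
  "uea_incl scale brk x = uea_ideal scale brk +>\<^bsub>free_assoc_algebra\<^esub> gen x"

definition ordered_monomial ::
    "('a, 'm) monoid_scheme \<Rightarrow> 'a \<Rightarrow> 'a \<Rightarrow> 'a \<Rightarrow> 'a \<Rightarrow> 'a \<Rightarrow> nat \<Rightarrow> nat \<Rightarrow> nat \<Rightarrow> nat \<Rightarrow> nat \<Rightarrow> 'a" where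
  "ordered_monomial U y1 y2 y3 y4 y5 a b c d e =
     y1 [^]\<^bsub>U\<^esub> a \<otimes>\<^bsub>U\<^esub> y2 [^]\<^bsub>U\<^esub> b \<otimes>\<^bsub>U\<^esub> y3 [^]\<^bsub>U\<^esub> c \<otimes>\<^bsub>U\<^esub> y4 [^]\<^bsub>U\<^esub> d \<otimes>\<^bsub>U\<^esub> y5 [^]\<^bsub>U\<^esub> e"


section \<open>The universal property\<close>

lemma free_simps [simp]:
  "carrier free_assoc_algebra = UNIV"
  "x \<otimes>\<^bsub>free_assoc_algebra\<^esub> y = x * y"
  "x \<oplus>\<^bsub>free_assoc_algebra\<^esub> y = x + y"
  "\<one>\<^bsub>free_assoc_algebra\<^esub> = 1"
  "\<zero>\<^bsub>free_assoc_algebra\<^esub> = 0"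
  "c \<odot>\<^bsub>free_assoc_algebra\<^esub> p = Poly_Mapping.single [] c * p"
  by (simp_all add: free_assoc_algebra_def)

lemma ring_free: "ring (free_assoc_algebra :: ('f::field, 'l list \<Rightarrow>\<^sub>0 'f) module)"
proof (rule ringI)
  show "abelian_group (free_assoc_algebra :: ('f, 'l list \<Rightarrow>\<^sub>0 'f) module)"
    by (rule abelian_groupI) (auto simp: algebra_simps intro: exI[of _ "- _"] left_minus)
  show "monoid (free_assoc_algebra :: ('f, 'l list \<Rightarrow>\<^sub>0 'f) module)"
    by (rule monoidI) (auto simp: algebra_simps)
qed (auto simp: algebra_simps)

lemma ideal_uea: "ideal (uea_ideal scale brk) free_assoc_algebra"
  unfolding uea_ideal_def by (rule ring.genideal_ideal[OF ring_free]) simp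

lemma uea_ideal_rel: "p \<in> uea_relations scale brk \<Longrightarrow> p \<in> uea_ideal scale brk"
  unfolding uea_ideal_def using ring.genideal_self[OF ring_free, of "uea_relations scale brk"] by auto

lemma single_Nil_commute:
  fixes p :: "'l list \<Rightarrow>\<^sub>0 'f::field"
  shows "p * Poly_Mapping.single [] c = Poly_Mapping.single [] c * p"
proof (induction p rule: update_induct)
  case const
  show ?case by simp
next
  case (update p w d)
  have eq: "Poly_Mapping.update w d p = p + Poly_Mapping.single w d"
    using update by (intro poly_mapping_eqI) (auto simp: lookup_add lookup_update lookup_single in_keys_iff when_def)
  show ?case using update
    by (simp add: eq distrib_left distrib_right mult_single plus_list_def mult.commute)
qed

context
  fixes scale :: "'f::field \<Rightarrow> 'l::ab_group_add \<Rightarrow> 'l" and brk :: "'l \<Rightarrow> 'l \<Rightarrow> 'l"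
begin

abbreviation (input) "cls p \<equiv> uea_ideal scale brk +>\<^bsub>free_assoc_algebra\<^esub> p"

lemma carrier_uea: "carrier (uea scale brk) = range cls"
  by (auto simp: uea_def Let_def FactRing_def A_RCOSETS_defs a_r_coset_def)

lemma cls_eq_iff: "cls p = cls q \<longleftrightarrow> p - q \<in> uea_ideal scale brk"
proof -
  interpret ideal "uea_ideal scale brk" free_assoc_algebra by (rule ideal_uea)
  have m: "\<ominus>\<^bsub>free_assoc_algebra\<^esub> y = - y" for y :: "'l list \<Rightarrow>\<^sub>0 'f"
    by (rule minus_equality) auto
  have "cls p = cls q \<longleftrightarrow> p \<ominus>\<^bsub>free_assoc_algebra\<^esub> q \<in> uea_ideal scale brk"
    by (rule quotient_eq_iff_same_a_r_cos[OF ideal_uea, symmetric]) auto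
  then show ?thesis by (simp add: a_minus_def m)
qed

lemma uea_mult: "cls p \<otimes>\<^bsub>uea scale brk\<^esub> cls q = cls (p * q)"
  using ideal.rcoset_mult_add[OF ideal_uea, of p q scale brk]
  by (simp add: uea_def Let_def FactRing_def)

lemma uea_add: "cls p \<oplus>\<^bsub>uea scale brk\<^esub> cls q = cls (p + q)"
proof -
  interpret ideal "uea_ideal scale brk" free_assoc_algebra by (rule ideal_uea)
  show ?thesis using a_rcos_sum[of p q] by (simp add: uea_def Let_def FactRing_def)
qed

lemma uea_one: "\<one>\<^bsub>uea scale brk\<^esub> = cls 1"
  by (simp add: uea_def Let_def FactRing_def)

lemma uea_zero: "\<zero>\<^bsub>uea scale brk\<^esub> = cls 0"
proof -
  interpret ideal "uea_ideal scale brk" free_assoc_algebra by (rule ideal_uea)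
  show ?thesis using a_rcos_const[OF additive_subgroup.zero_closed[OF is_additive_subgroup]] by (simp add: uea_def Let_def FactRing_def)
qed

lemma uea_smult: "c \<odot>\<^bsub>uea scale brk\<^esub> cls p = cls (Poly_Mapping.single [] c * p)"
proof -
  interpret ideal "uea_ideal scale brk" free_assoc_algebra by (rule ideal_uea)
  have self: "p \<in> cls p" using a_rcos_self[of p] by simp
  have "cls (Poly_Mapping.single [] c * q) = cls (Poly_Mapping.single [] c * p)" if "q \<in> cls p" for q
  proof -
    from that obtain i where i: "i \<in> uea_ideal scale brk" "q = i + p"
      by (auto simp: a_r_coset_def r_coset_def)
    have "Poly_Mapping.single [] c * i \<in> uea_ideal scale brk"
      using I_l_closed[OF i(1), of "Poly_Mapping.single [] c"] by simp
    then show ?thesis by (simp add: cls_eq_iff i(2) distrib_left)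
  qed
  then have "(\<Union>q\<in>cls p. cls (Poly_Mapping.single [] c * q)) = (\<Union>q\<in>cls p. cls (Poly_Mapping.single [] c * p))"
    by (intro SUP_cong refl)
  also have "\<dots> = cls (Poly_Mapping.single [] c * p)"
    using self by blast
  finally show ?thesis by (simp add: uea_def Let_def)
qed

lemma ring_uea: "ring (uea scale brk)"
proof (rule ringI)
  show "abelian_group (uea scale brk)"
  proof (rule abelian_groupI)
    fix x assume "x \<in> carrier (uea scale brk)"
    then obtain p where x: "x = cls p" by (auto simp: carrier_uea)
    show "\<exists>y\<in>carrier (uea scale brk). y \<oplus>\<^bsub>uea scale brk\<^esub> x = \<zero>\<^bsub>uea scale brk\<^esub>"
      by (rule bexI[of _ "cls (- p)"]) (simp_all add: x carrier_uea uea_add uea_zero)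
  qed (auto simp: carrier_uea uea_add uea_zero ac_simps)
  show "monoid (uea scale brk)"
    by (rule monoidI) (auto simp: carrier_uea uea_mult uea_one algebra_simps)
qed (auto simp: carrier_uea uea_mult uea_add algebra_simps)

lemma assoc_algebra_uea: "assoc_algebra (uea scale brk)"
proof (rule assoc_algebra.intro[OF ring_uea], rule assoc_algebra_axioms.intro)
  fix x y :: "('l list \<Rightarrow>\<^sub>0 'f) set" and c d :: 'f
  assume "x \<in> carrier (uea scale brk)"
  then obtain p where x: "x = cls p" by (auto simp: carrier_uea)
  show "c \<odot>\<^bsub>uea scale brk\<^esub> x \<in> carrier (uea scale brk)"
    by (simp add: x uea_smult carrier_uea)
  show "(c + d) \<odot>\<^bsub>uea scale brk\<^esub> x = c \<odot>\<^bsub>uea scale brk\<^esub> x \<oplus>\<^bsub>uea scale brk\<^esub> d \<odot>\<^bsub>uea scale brk\<^esub> x"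
    by (simp add: x uea_smult uea_add single_add distrib_right)
  show "c \<odot>\<^bsub>uea scale brk\<^esub> (d \<odot>\<^bsub>uea scale brk\<^esub> x) = (c * d) \<odot>\<^bsub>uea scale brk\<^esub> x"
    by (simp add: x uea_smult mult_single plus_list_def flip: mult.assoc)
  show "1 \<odot>\<^bsub>uea scale brk\<^esub> x = x"
    using single_one[where 'a = "'l list" and 'b = 'f] by (simp add: x uea_smult zero_list_def)
  assume "y \<in> carrier (uea scale brk)"
  then obtain q where y: "y = cls q" by (auto simp: carrier_uea)
  show "c \<odot>\<^bsub>uea scale brk\<^esub> (x \<oplus>\<^bsub>uea scale brk\<^esub> y) = c \<odot>\<^bsub>uea scale brk\<^esub> x \<oplus>\<^bsub>uea scale brk\<^esub> c \<odot>\<^bsub>uea scale brk\<^esub> y"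
    by (simp add: x y uea_smult uea_add distrib_left)
  show "(c \<odot>\<^bsub>uea scale brk\<^esub> x) \<otimes>\<^bsub>uea scale brk\<^esub> y = c \<odot>\<^bsub>uea scale brk\<^esub> (x \<otimes>\<^bsub>uea scale brk\<^esub> y)"
    by (simp add: x y uea_smult uea_mult mult.assoc)
  show "x \<otimes>\<^bsub>uea scale brk\<^esub> (c \<odot>\<^bsub>uea scale brk\<^esub> y) = c \<odot>\<^bsub>uea scale brk\<^esub> (x \<otimes>\<^bsub>uea scale brk\<^esub> y)"
    by (simp add: x y uea_smult uea_mult single_Nil_commute flip: mult.assoc)
qed

lemma lie_map_uea_incl: "uea_incl scale brk \<in> lie_map scale brk (uea scale brk)"
proof -
  interpret ring "uea scale brk" by (rule ring_uea)
  have neg: "\<ominus>\<^bsub>uea scale brk\<^esub> cls p = cls (- p)" for p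
    by (rule minus_equality) (auto simp: carrier_uea uea_add uea_zero)
  have "gen (x + y) - (gen x + gen y) \<in> uea_ideal scale brk" for x y :: 'l
    by (rule uea_ideal_rel) (auto simp: uea_relations_def)
  moreover have "gen (scale c x) - Poly_Mapping.single [] c * gen x \<in> uea_ideal scale brk" for c :: 'f and x :: 'l
    by (rule uea_ideal_rel) (auto simp: uea_relations_def)
  moreover have "gen (brk x y) - (gen x * gen y - gen y * gen x) \<in> uea_ideal scale brk" for x y :: 'l
    by (rule uea_ideal_rel) (auto simp: uea_relations_def)
  ultimately show ?thesis
    by (auto simp: lie_map_def uea_incl_def carrier_uea uea_add uea_smult uea_mult a_minus_def neg
        cls_eq_iff)
qed

end

context assoc_algebra
begin

definition word_value :: "('l \<Rightarrow> 'a) \<Rightarrow> 'l list \<Rightarrow> 'a" where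
  "word_value \<phi> w = foldr (\<lambda>x u. \<phi> x \<otimes> u) w \<one>"

definition free_value :: "('l \<Rightarrow> 'a) \<Rightarrow> ('l list \<Rightarrow>\<^sub>0 'f) \<Rightarrow> 'a" where
  "free_value \<phi> p = (\<Oplus>w\<in>Poly_Mapping.keys p. Poly_Mapping.lookup p w \<odot> word_value \<phi> w)"

lemma smult_0: "x \<in> carrier A \<Longrightarrow> 0 \<odot> x = \<zero>"
  using smult_add_left[of x 0 0] smult_closed[of x 0] by simp

context
  fixes \<phi> :: "'l \<Rightarrow> 'a"
  assumes \<phi>: "\<And>x. \<phi> x \<in> carrier A"
begin

lemma word_value_closed [simp]: "word_value \<phi> w \<in> carrier A"
  by (induction w) (auto simp: word_value_def \<phi>)

lemma word_value_append: "word_value \<phi> (v @ w) = word_value \<phi> v \<otimes> word_value \<phi> w"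
proof (induction v)
  case Nil
  then show ?case using word_value_closed[of w] by (simp add: word_value_def)
next
  case (Cons x v)
  then show ?case using word_value_closed[of w] word_value_closed[of v] \<phi>
    by (simp add: word_value_def m_assoc)
qed

lemma free_value_superset:
  assumes "finite S" "Poly_Mapping.keys p \<subseteq> S"
  shows "free_value \<phi> p = (\<Oplus>w\<in>S. Poly_Mapping.lookup p w \<odot> word_value \<phi> w)"
  unfolding free_value_def using assms
  by (intro add.finprod_mono_neutral_cong_left) (auto simp: in_keys_iff smult_0 smult_closed)

lemma free_value_closed [simp]: "free_value \<phi> p \<in> carrier A"
  unfolding free_value_def by (intro finsum_closed) (auto simp: smult_closed)

lemma free_value_add: "free_value \<phi> (p + q) = free_value \<phi> p \<oplus> free_value \<phi> q"
proof -
  let ?S = "Poly_Mapping.keys p \<union> Poly_Mapping.keys q"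
  have "free_value \<phi> (p + q) = (\<Oplus>w\<in>?S. Poly_Mapping.lookup (p + q) w \<odot> word_value \<phi> w)"
    by (rule free_value_superset) (use keys_add[of p q] in auto)
  also have "\<dots> = (\<Oplus>w\<in>?S. Poly_Mapping.lookup p w \<odot> word_value \<phi> w \<oplus> Poly_Mapping.lookup q w \<odot> word_value \<phi> w)"
    by (intro finsum_cong') (auto simp: lookup_add smult_add_left smult_closed)
  also have "\<dots> = (\<Oplus>w\<in>?S. Poly_Mapping.lookup p w \<odot> word_value \<phi> w) \<oplus> (\<Oplus>w\<in>?S. Poly_Mapping.lookup q w \<odot> word_value \<phi> w)"
    by (intro finsum_addf) (auto simp: smult_closed)
  also have "\<dots> = free_value \<phi> p \<oplus> free_value \<phi> q"
    by (subst (1 2) free_value_superset[of ?S]) auto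
  finally show ?thesis .
qed

lemma free_value_single: "free_value \<phi> (Poly_Mapping.single w c) = c \<odot> word_value \<phi> w"
  by (subst free_value_superset[of "{w}"]) (auto simp: smult_closed)

lemma free_value_zero: "free_value \<phi> 0 = \<zero>"
  by (simp add: free_value_def)

lemma free_value_mult_single:
  "free_value \<phi> (Poly_Mapping.single v c * q) = (c \<odot> word_value \<phi> v) \<otimes> free_value \<phi> q"
proof (induction q rule: update_induct)
  case const
  show ?case by (simp add: free_value_zero smult_closed)
next
  case (update p w d)
  have eq: "Poly_Mapping.update w d p = p + Poly_Mapping.single w d"
    using update by (intro poly_mapping_eqI) (auto simp: lookup_add lookup_update lookup_single in_keys_iff when_def)
  show ?case using update
    by (simp add: eq distrib_left mult_single free_value_add free_value_single smult_closed r_distr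
        plus_list_def word_value_append smult_mult_left smult_mult_right smult_smult mult.commute)
qed

lemma free_value_mult: "free_value \<phi> (p * q) = free_value \<phi> p \<otimes> free_value \<phi> q"
proof (induction p rule: update_induct)
  case const
  show ?case by (simp add: free_value_zero)
next
  case (update p w d)
  have eq: "Poly_Mapping.update w d p = p + Poly_Mapping.single w d"
    using update by (intro poly_mapping_eqI) (auto simp: lookup_add lookup_update lookup_single in_keys_iff when_def)
  show ?case using update
    by (simp add: eq distrib_right free_value_add free_value_single smult_closed l_distr
        free_value_mult_single)
qed

lemma free_value_one: "free_value \<phi> 1 = \<one>"
  using free_value_single[of "[]" 1] single_one[where 'a = "'l list" and 'b = 'f]
  by (simp add: word_value_def smult_1 zero_list_def)

lemma free_value_gen: "free_value \<phi> (gen x) = \<phi> x"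
  using \<phi> by (simp add: gen_def free_value_single word_value_def smult_1)

lemma free_value_smult: "free_value \<phi> (Poly_Mapping.single [] c * p) = c \<odot> free_value \<phi> p"
  by (simp add: free_value_mult_single) (simp add: word_value_def smult_mult_left)

lemma free_value_minus: "free_value \<phi> (p - q) = free_value \<phi> p \<ominus> free_value \<phi> q"
proof -
  have "free_value \<phi> (p - q) \<oplus> free_value \<phi> q = free_value \<phi> p"
    by (simp flip: free_value_add)
  then show ?thesis
    by (metis add.inv_solve_right a_minus_def free_value_closed)
qed

end

text \<open>The target algebra may live in any type, so this is the full universal property,
  existence and uniqueness.\<close>

theorem uea_universal:
  fixes scale :: "'f \<Rightarrow> 'l::ab_group_add \<Rightarrow> 'l"
  assumes lie: "\<phi> \<in> lie_map scale brk A"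
  shows "\<exists>f \<in> algebra_hom (uea scale brk) A. \<forall>x. f (uea_incl scale brk x) = \<phi> x"
    and "\<lbrakk>f \<in> algebra_hom (uea scale brk) A; g \<in> algebra_hom (uea scale brk) A;
          \<And>x. f (uea_incl scale brk x) = \<phi> x; \<And>x. g (uea_incl scale brk x) = \<phi> x;
          u \<in> carrier (uea scale brk)\<rbrakk> \<Longrightarrow> f u = g u"
proof -
  let ?I = "uea_ideal scale brk" and ?U = "uea scale brk"
  let ?c = "\<lambda>p. ?I +>\<^bsub>free_assoc_algebra\<^esub> p"
  have \<phi>: "\<phi> x \<in> carrier A" for x using lie by (auto simp: lie_map_def)
  note [simp] = free_value_closed[OF \<phi>]
  have self0: "x \<ominus> x = \<zero>" if "x \<in> carrier A" for x
    using that by (simp add: a_minus_def r_neg)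
  have minus_zeroD: "x = y" if "x \<ominus> y = \<zero>" "x \<in> carrier A" "y \<in> carrier A" for x y
  proof -
    have "x = (x \<ominus> y) \<oplus> y" using that(2,3) by (simp add: a_minus_def a_assoc l_neg)
    then show ?thesis using that by simp
  qed
  let ?K = "{p. free_value \<phi> p = \<zero>}"
  have rels: "uea_relations scale brk \<subseteq> ?K"
    using lie \<phi> unfolding uea_relations_def
    by (auto simp: lie_map_def free_value_minus free_value_add free_value_gen self0 smult_closed
        free_value_smult; simp add: free_value_mult free_value_gen self0)
  have fneg: "free_value \<phi> p = \<zero> \<Longrightarrow> free_value \<phi> (- p) = \<zero>" for p
    using free_value_minus[OF \<phi>, where p = 0 and q = p] by (simp add: free_value_zero[OF \<phi>] self0)
  have idK: "ideal ?K free_assoc_algebra"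
  proof (rule idealI[OF ring_free])
    interpret F: ring "free_assoc_algebra :: ('f, 'l list \<Rightarrow>\<^sub>0 'f) module" by (rule ring_free)
    have m: "\<ominus>\<^bsub>free_assoc_algebra\<^esub> y = - y" for y :: "'l list \<Rightarrow>\<^sub>0 'f"
      by (rule F.minus_equality) auto
    show "subgroup ?K (add_monoid free_assoc_algebra)"
    proof (rule F.add.subgroupI)
      show "\<And>a. a \<in> ?K \<Longrightarrow> \<ominus>\<^bsub>free_assoc_algebra\<^esub> a \<in> ?K" unfolding m using fneg by simp
    qed (auto simp: free_value_add[OF \<phi>] intro!: exI[of _ 0] free_value_zero[OF \<phi>])
  qed (auto simp: free_value_mult[OF \<phi>])
  have IK: "?I \<subseteq> ?K"
    unfolding uea_ideal_def by (rule ring.genideal_minimal[OF ring_free idK rels])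
  define f where "f X = free_value \<phi> (SOME p. X = ?c p)" for X
  have f: "f (?c p) = free_value \<phi> p" for p
  proof -
    have "?c p = ?c (SOME q. ?c p = ?c q)" by (rule someI) simp
    then have "p - (SOME q. ?c p = ?c q) \<in> ?K"
      using IK cls_eq_iff[of scale brk] by blast
    then have "free_value \<phi> p \<ominus> free_value \<phi> (SOME q. ?c p = ?c q) = \<zero>"
      by (simp add: free_value_minus[OF \<phi>])
    then have "free_value \<phi> p = free_value \<phi> (SOME q. ?c p = ?c q)"
      by (rule minus_zeroD) simp_all
    then show ?thesis unfolding f_def by (rule sym)
  qed
  have "f \<in> algebra_hom ?U A"
    unfolding algebra_hom_def
    by (auto intro!: ring_hom_memI simp: carrier_uea uea_mult uea_add uea_one uea_smult f
        free_value_add[OF \<phi>] free_value_mult[OF \<phi>] free_value_one[OF \<phi>])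
       (simp add: free_value_smult[OF \<phi>] flip: free_value_mult[OF \<phi>])
  moreover have "f (uea_incl scale brk x) = \<phi> x" for x
    by (simp add: uea_incl_def f free_value_gen[OF \<phi>])
  ultimately show "\<exists>f \<in> algebra_hom ?U A. \<forall>x. f (uea_incl scale brk x) = \<phi> x" by blast
  fix f g u
  assume fg: "f \<in> algebra_hom ?U A" "g \<in> algebra_hom ?U A"
    "\<And>x. f (uea_incl scale brk x) = \<phi> x" "\<And>x. g (uea_incl scale brk x) = \<phi> x"
    and u: "u \<in> carrier ?U"
  have *: "h (?c p) = free_value \<phi> p" if h: "h \<in> algebra_hom ?U A" "\<And>x. h (uea_incl scale brk x) = \<phi> x"
    for h p
  proof -
    have hadd: "h (?c (p + q)) = h (?c p) \<oplus> h (?c q)" for p q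
      using h(1) by (auto simp: algebra_hom_def carrier_uea uea_add dest: ring_hom_add[of h _ _ "?c p" "?c q"])
    have hmult: "h (?c (p * q)) = h (?c p) \<otimes> h (?c q)" for p q
      using h(1) by (auto simp: algebra_hom_def carrier_uea uea_mult dest: ring_hom_mult[of h _ _ "?c p" "?c q"])
    have hone: "h (?c 1) = \<one>"
      using h(1) by (auto simp: algebra_hom_def uea_one dest: ring_hom_one)
    have hsm: "h (?c (Poly_Mapping.single [] c * p)) = c \<odot> h (?c p)" for c p
      using h(1) by (auto simp: algebra_hom_def carrier_uea uea_smult[symmetric])
    have hcl: "h (?c p) \<in> carrier A" for p
      using h(1) ring_hom_closed[of h ?U A "?c p"] by (simp add: algebra_hom_def carrier_uea)
    have hzero: "h (?c 0) = \<zero>"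
      using hsm[of 0 0] hcl[of 0] by (simp add: smult_0)
    have hw: "h (?c (Poly_Mapping.single w 1)) = word_value \<phi> w" for w
    proof (induction w)
      case Nil
      show ?case using hone single_one[where 'a = "'l list" and 'b = 'f] by (simp add: word_value_def zero_list_def)
    next
      case (Cons x w)
      have "Poly_Mapping.single (x # w) 1 = gen x * Poly_Mapping.single w (1::'f)"
        by (simp add: gen_def mult_single plus_list_def)
      then show ?case using Cons h(2)[of x] by (simp add: hmult uea_incl_def word_value_def)
    qed
    have hs: "h (?c (Poly_Mapping.single w c)) = c \<odot> word_value \<phi> w" for w c
      using hsm[of c "Poly_Mapping.single w 1"] by (simp add: hw mult_single plus_list_def)
    show ?thesis
    proof (induction p rule: update_induct)
      case const
      show ?case by (simp add: hzero free_value_zero[OF \<phi>])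
    next
      case (update p w d)
      have eq: "Poly_Mapping.update w d p = p + Poly_Mapping.single w d"
        using update by (intro poly_mapping_eqI) (auto simp: lookup_add lookup_update lookup_single in_keys_iff when_def)
      show ?case using update by (simp add: eq hadd hs free_value_add[OF \<phi>] free_value_single[OF \<phi>])
    qed
  qed
  from u obtain p where "u = ?c p" by (auto simp: carrier_uea)
  then show "f u = g u" using *[of f p] *[of g p] fg by simp
qed

end


section \<open>A model\<close>

text \<open>The conditions in \<^locale>\<open>lie_algebra_n56\<close> determine the Lie algebra up to isomorphism;
  they are consistent over every field.\<close>

definition n56_scale :: "'f::field \<Rightarrow> 'f \<times> 'f \<times> 'f \<times> 'f \<times> 'f \<Rightarrow> 'f \<times> 'f \<times> 'f \<times> 'f \<times> 'f" where
  "n56_scale c = (\<lambda>(a1, a2, a3, a4, a5). (c * a1, c * a2, c * a3, c * a4, c * a5))"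

definition n56_brk ::
    "'f::field \<times> 'f \<times> 'f \<times> 'f \<times> 'f \<Rightarrow> 'f \<times> 'f \<times> 'f \<times> 'f \<times> 'f \<Rightarrow> 'f \<times> 'f \<times> 'f \<times> 'f \<times> 'f" where
  "n56_brk = (\<lambda>(a1, a2, a3, a4, a5) (b1, b2, b3, b4, b5).
     (a3 * b4 - a4 * b3 + a2 * b5 - a5 * b2, a3 * b5 - a5 * b3, a4 * b5 - a5 * b4, 0, 0))"

lemma lie_algebra_n56_model:
  "lie_algebra_n56 (n56_scale :: 'f::field \<Rightarrow> _) n56_brk
     (1, 0, 0, 0, 0) (0, 1, 0, 0, 0) (0, 0, 1, 0, 0) (0, 0, 0, 1, 0) (0, 0, 0, 0, 1)"
proof -
  interpret V: vector_space "n56_scale :: 'f \<Rightarrow> _"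
    by standard (auto simp: n56_scale_def algebra_simps split: prod.splits)
  interpret L: lie_algebra "n56_scale :: 'f \<Rightarrow> _" n56_brk
  proof
    fix x y z :: "'f \<times> 'f \<times> 'f \<times> 'f \<times> 'f" and c :: 'f
    obtain a1 a2 a3 a4 a5 where x: "x = (a1, a2, a3, a4, a5)" by (metis prod.exhaust)
    obtain b1 b2 b3 b4 b5 where y: "y = (b1, b2, b3, b4, b5)" by (metis prod.exhaust)
    obtain d1 d2 d3 d4 d5 where z: "z = (d1, d2, d3, d4, d5)" by (metis prod.exhaust)
    note defs = x y z n56_scale_def n56_brk_def zero_prod_def
    show "n56_brk (x + y) z = n56_brk x z + n56_brk y z" by (simp add: defs algebra_simps)
    show "n56_brk x (y + z) = n56_brk x y + n56_brk x z" by (simp add: defs algebra_simps)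
    show "n56_brk (n56_scale c x) y = n56_scale c (n56_brk x y)" by (simp add: defs algebra_simps)
    show "n56_brk x (n56_scale c y) = n56_scale c (n56_brk x y)" by (simp add: defs algebra_simps)
    show "n56_brk x x = 0" by (simp add: defs)
    show "n56_brk x (n56_brk y z) + n56_brk y (n56_brk z x) + n56_brk z (n56_brk x y) = 0"
      by (simp add: defs algebra_simps)
  qed
  let ?B = "{(1, 0, 0, 0, 0), (0, 1, 0, 0, 0), (0, 0, 1, 0, 0), (0, 0, 0, 1, 0), (0, 0, 0, 0, 1)} ::
    ('f \<times> 'f \<times> 'f \<times> 'f \<times> 'f) set"
  have "V.independent ?B"
    by (simp add: V.dependent_finite n56_scale_def zero_prod_def)
  show ?thesis
  proof (unfold_locales)
    show "V.independent ?B"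
      by fact
    show "V.span ?B = UNIV"
    proof (rule UNIV_eq_I[symmetric])
      fix v :: "'f \<times> 'f \<times> 'f \<times> 'f \<times> 'f"
      obtain a1 a2 a3 a4 a5 where v: "v = (a1, a2, a3, a4, a5)" by (metis prod.exhaust)
      have "v = n56_scale a1 (1, 0, 0, 0, 0) + (n56_scale a2 (0, 1, 0, 0, 0) +
         (n56_scale a3 (0, 0, 1, 0, 0) + (n56_scale a4 (0, 0, 0, 1, 0) + n56_scale a5 (0, 0, 0, 0, 1))))"
        by (simp add: v n56_scale_def)
      also have "\<dots> \<in> V.span ?B"
        by (intro V.span_add V.span_scale V.span_base) auto
      finally show "v \<in> V.span ?B" .
    qed
  qed (auto simp: n56_brk_def zero_prod_def)
qed

end

theory Submission
  imports "HOL-Computational_Algebra.Formal_Power_Series" Defs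
begin

text \<open>
  The identity is a consequence of the defining commutation relations: it holds in every ring
  with central scalars from a field of characteristic \<open>0\<close> that contains five elements
  satisfying these relations (\<open>pbw_mult_pbw\<close>).

  Reordering means moving \<open>x\<^sub>5\<^sup>n\<close> to the right of \<open>x\<^sub>2\<^sup>q x\<^sub>3\<^sup>r x\<^sub>4\<^sup>s\<close>. All \<open>n\<close> are treated at once by
  the series \<open>exp (t x\<^sub>5) = \<Sum> t\<^sup>n x\<^sub>5\<^sup>n / n!\<close> in a central variable \<open>t\<close>, because conjugation by it is the
  ring automorphism \<open>exp (t ad x\<^sub>5)\<close> (\<open>gexp_conj\<close>):

    \<open>x\<^sub>2 \<mapsto> x\<^sub>2 - t x\<^sub>1\<close>,
    \<open>x\<^sub>3 \<mapsto> x\<^sub>3 - t x\<^sub>2 + t\<^sup>2/2 x\<^sub>1\<close>,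
    \<open>x\<^sub>4 \<mapsto> x\<^sub>4 - t x\<^sub>3 + t\<^sup>2/2 x\<^sub>2 - t\<^sup>3/6 x\<^sub>1\<close>.

  Hence \<open>exp (t x\<^sub>5) x\<^sub>2\<^sup>q x\<^sub>3\<^sup>r x\<^sub>4\<^sup>s\<close> is the product of the \<open>q\<close>-th, \<open>r\<close>-th and \<open>s\<close>-th powers of the right-hand
  sides, times \<open>exp (t x\<^sub>5)\<close>, and the coefficient of \<open>t\<^sup>n\<close> is wanted (\<open>divpow_reorder\<close>). The summands of the
  first two right-hand sides commute, and their powers are expanded by the binomial and the trinomial
  formula: this gives the indices \<open>\<alpha>\<close> and \<open>\<beta>\<^sub>1, \<beta>\<^sub>2\<close>. In the third, \<open>x\<^sub>4\<close> and \<open>- t x\<^sub>3\<close> do not commute, but their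
  commutator \<open>t x\<^sub>1\<close> is central, so that the Baker-Campbell-Hausdorff formula
  \<open>exp (a + b) = exp ([a, b] / 2) exp b exp a\<close> applies (\<open>gexp_add_heisenberg\<close>, \<open>divpow_heisenberg\<close>); the
  factor \<open>exp ([a, b] / 2)\<close> is where \<open>\<gamma>\<^sub>4\<close> comes from, and \<open>\<gamma>\<^sub>1, \<gamma>\<^sub>2, \<gamma>\<^sub>3\<close> count the other three correction
  terms. Finally \<open>x\<^sub>4\<^sup>m\<close> has to pass the power of \<open>x\<^sub>3\<close> that has been produced, which is the same computation
  as for \<open>x\<^sub>5\<close> and \<open>x\<^sub>2\<close> (\<open>divpow_swap\<close>) and gives \<open>\<delta>\<close>. In terms of the divided powers \<open>x\<^sup>n / n!\<close> the only
  coefficients in all these expansions are powers of the constants \<open>- 1\<close>, \<open>1/2\<close> and \<open>- 1/6\<close>; the binomial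
  coefficients of the statement appear when the factorials are put back (\<open>reorder_coeff_eq\<close>).

  Power series over a ring need the ring to be a type of class \<open>ring_1\<close>, whereas the enveloping algebra
  is a carrier set that depends on the Lie algebra. The enveloping algebra of the concrete five-dimensional
  model, however, depends on no parameter except the field and so can be made a type. The computation is done there
  and is transported along the homomorphism that the universal property provides
  (\<open>obtain_uea_hom\<close>).
\<close>

unbundle fps_syntax

section \<open>Power series over a noncommutative ring\<close>

lemma fps_const_commuteI: "(\<And>n. (y::'a::semiring_1) * F $ n = F $ n * y) \<Longrightarrow> fps_const y * F = F * fps_const y"
  by (rule fps_ext) simp

lemma fps_monomial_mult:
  fixes a b :: "'a::semiring_1"
  shows "(fps_X ^ i * fps_const a) * (fps_X ^ j * fps_const b) = fps_X ^ (i + j) * fps_const (a * b)"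
  by (metis (no_types) fps_const_mult fps_mult_fps_X_power_commute mult.assoc power_add)

lemmas fps_monomial_const_mult = fps_monomial_mult[where j = 0, unfolded power_0 mult_1 add_0_right]

lemma fps_monomial_commute:
  fixes a b :: "'a::semiring_1"
  assumes "a * b = b * a"
  shows "(fps_X ^ i * fps_const a) * (fps_X ^ j * fps_const b) = (fps_X ^ j * fps_const b) * (fps_X ^ i * fps_const a)"
  by (simp only: fps_monomial_mult assms add.commute)

lemmas fps_const_monomial_commute =
  fps_monomial_commute[where i = 0, unfolded power_0 mult_1]
  fps_monomial_commute[where j = 0, unfolded power_0 mult_1]
  fps_monomial_commute[where i = 0 and j = 0, unfolded power_0 mult_1]

text \<open>Extracting a coefficient turns the exponent of the variable into a bound on the summation
  index: the source of the conditions on \<open>\<alpha>\<close>, \<open>\<beta>\<close> and \<open>\<gamma>\<close> that involve \<open>n\<close>.\<close>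

lemma sum_monomials_mult_nth:
  fixes c :: "'i \<Rightarrow> 'a::semiring_1"
  assumes "finite S"
  shows "((\<Sum>i\<in>S. fps_X ^ w i * fps_const (c i)) * F) $ n = (\<Sum>i | i \<in> S \<and> w i \<le> n. c i * F $ (n - w i))"
proof -
  have "((\<Sum>i\<in>S. fps_X ^ w i * fps_const (c i)) * F) $ n = (\<Sum>i\<in>S. if w i \<le> n then c i * F $ (n - w i) else 0)"
    by (simp add: sum_distrib_right fps_sum_nth mult.assoc fps_X_power_mult_nth not_less cong: if_cong)
       (auto intro!: sum.cong)
  then show ?thesis using assms by (simp add: sum.inter_filter)
qed

text \<open>Indexing the terms by an arbitrary type with a weight keeps the coefficients of a product of several
  series as single sums over tuples of indices, without nested Cauchy products.\<close>

definition fps_family :: "'a::ring_1 fps \<Rightarrow> ('i \<Rightarrow> nat) \<Rightarrow> ('i \<Rightarrow> 'a) \<Rightarrow> bool" where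
  "fps_family F w g \<longleftrightarrow> (\<forall>n. finite {x. w x = n} \<and> F $ n = (\<Sum>x | w x = n. g x))"

lemma fps_family_mult:
  assumes "fps_family F v f" "fps_family G w g"
  shows "fps_family (F * G) (\<lambda>(x, y). v x + w y) (\<lambda>(x, y). f x * g y)"
  unfolding fps_family_def
proof (intro allI conjI)
  fix n
  let ?S = "{p. (case p of (x, y) \<Rightarrow> v x + w y) = n}"
  have fin: "finite {x. v x = i}" "finite {y. w y = i}" for i
    using assms by (auto simp: fps_family_def)
  have "?S \<subseteq> (\<Union>i\<le>n. \<Union>j\<le>n. {x. v x = i} \<times> {y. w y = j})" by auto
  then show finS: "finite ?S"
    by (rule finite_subset) (auto intro!: fin)
  have "(F * G) $ n = (\<Sum>i=0..n. (\<Sum>x | v x = i. f x) * (\<Sum>y | w y = n - i. g y))"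
    using assms by (simp add: fps_mult_nth fps_family_def)
  also have "\<dots> = (\<Sum>i=0..n. \<Sum>p | p \<in> ?S \<and> v (fst p) = i. case p of (x, y) \<Rightarrow> f x * g y)"
  proof (rule sum.cong[OF refl])
    fix i assume "i \<in> {0..n}"
    then have "{p. p \<in> ?S \<and> v (fst p) = i} = {x. v x = i} \<times> {y. w y = n - i}" by auto
    then show "(\<Sum>x | v x = i. f x) * (\<Sum>y | w y = n - i. g y) =
        (\<Sum>p | p \<in> ?S \<and> v (fst p) = i. case p of (x, y) \<Rightarrow> f x * g y)"
      by (simp add: sum_product sum.cartesian_product)
  qed
  also have "\<dots> = (\<Sum>p\<in>?S. case p of (x, y) \<Rightarrow> f x * g y)"
    by (rule sum.group) (use finS in auto)
  finally show "(F * G) $ n = (\<Sum>p\<in>?S. case p of (x, y) \<Rightarrow> f x * g y)" .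
qed

section \<open>Divided powers and exponential series\<close>

text \<open>An associative algebra over a field, given by its structure map \<open>c \<mapsto> c \<cdot> 1\<close> into the centre. The scalars
  can thus be carried over to power series by composing with the embedding of constants.\<close>

locale central_scalars =
  fixes sc :: "'f::field_char_0 \<Rightarrow> 'a::ring_1"
  assumes sc_add: "sc (a + b) = sc a + sc b"
    and sc_mult: "sc (a * b) = sc a * sc b"
    and sc_one [simp]: "sc 1 = 1"
    and sc_central: "x * sc c = sc c * x"
begin

lemma sc_zero [simp]: "sc 0 = 0"
  using sc_add[of 0 0] by simp

lemma sc_minus: "sc (- a) = - sc a"
  using sc_add[of a "- a"] by (simp add: eq_neg_iff_add_eq_0 add.commute)

lemma sc_of_nat: "sc (of_nat n) = of_nat n"
  by (induction n) (simp_all add: sc_add)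

lemma sc_left_commute: "x * (sc c * y) = sc c * (x * y)"
  by (metis mult.assoc sc_central)

lemma sc_sc: "sc a * (sc b * x) = sc (a * b) * x"
  by (simp add: sc_mult mult.assoc)

lemma scaled_mult: "(sc a * x) * (sc b * y) = sc (a * b) * (x * y)"
  by (simp only: mult.assoc sc_left_commute[of x] sc_sc)

lemma scaled_commute:
  assumes "x * y = y * x"
  shows "(sc a * x) * (sc b * y) = (sc b * y) * (sc a * x)"
    and "x * (sc b * y) = (sc b * y) * x"
    and "(sc b * x) * y = y * (sc b * x)"
  using scaled_mult[of a x b y] scaled_mult[of b y a x] scaled_mult[of 1 x b y] scaled_mult[of b y 1 x]
    scaled_mult[of b x 1 y] scaled_mult[of 1 y b x]
  by (simp_all add: assms mult.commute[of a])

lemma of_nat_cancel: "of_nat (Suc n) * x = of_nat (Suc n) * y \<Longrightarrow> x = (y :: 'a)"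
proof -
  assume *: "of_nat (Suc n) * x = of_nat (Suc n) * y"
  have inv: "sc (1 / of_nat (Suc n)) * (of_nat (Suc n) * z) = z" for z :: 'a
    using sc_sc[of "1 / of_nat (Suc n)" "of_nat (Suc n)" z]
    unfolding sc_of_nat by (simp del: of_nat_Suc)
  show "x = y" using arg_cong[OF *, of "\<lambda>z. sc (1 / of_nat (Suc n)) * z"] unfolding inv .
qed

definition divpow :: "'a \<Rightarrow> nat \<Rightarrow> 'a" where
  "divpow x n = sc (1 / fact n) * x ^ n"

text \<open>The exponential series \<open>exp (t x)\<close> in a variable \<open>t\<close> that commutes with everything.\<close>

definition gexp :: "'a \<Rightarrow> 'a fps" where
  "gexp x = Abs_fps (divpow x)"

lemma divpow_0 [simp]: "divpow x 0 = 1"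
  by (simp add: divpow_def)

lemma gexp_nth [simp]: "gexp x $ n = divpow x n"
  by (simp add: gexp_def)

lemma divpow_Suc: "of_nat (Suc n) * divpow x (Suc n) = x * divpow x n"
proof -
  have "of_nat (Suc n) * divpow x (Suc n) = sc (of_nat (Suc n) * (1 / fact (Suc n))) * x ^ Suc n"
    by (simp only: divpow_def sc_sc sc_of_nat[symmetric])
  also have "of_nat (Suc n) * (1 / fact (Suc n)) = (1 / fact n :: 'f)"
    by (simp add: field_simps del: of_nat_Suc)
  finally show ?thesis by (simp add: divpow_def sc_left_commute)
qed

lemma divpow_commute: "x * y = y * x \<Longrightarrow> y * divpow x n = divpow x n * y"
  by (simp add: divpow_def sc_left_commute power_commuting_commutes mult.assoc)

lemma power_eq_divpow: "x ^ n = sc (fact n) * divpow x n"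
  by (simp add: divpow_def sc_sc)

lemma divpow_scaled: "divpow (sc c * x) n = sc (c ^ n / fact n) * x ^ n"
proof -
  have "(sc c * x) ^ n = sc (c ^ n) * x ^ n"
  proof (induction n)
    case (Suc n)
    show ?case by (simp only: power_Suc Suc mult.assoc sc_left_commute[of x] sc_sc)
  qed simp
  then show ?thesis by (simp add: divpow_def sc_sc)
qed

lemma deriv_gexp: "fps_deriv (gexp x) = fps_const x * gexp x"
  by (rule fps_ext) (use divpow_Suc in simp)

text \<open>A series is determined by a linear differential equation with constant coefficient and by its
  constant term, since positive integers are invertible scalars. This replaces all inductions on exponents
  in the proofs of identities between exponential series.\<close>

lemma ode_unique:
  fixes K :: 'a
  assumes "fps_deriv F = fps_const K * F" "fps_deriv G = fps_const K * G" "F $ 0 = G $ 0"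
  shows "F = G"
proof (rule fps_ext)
  fix n show "F $ n = G $ n"
  proof (induction n)
    case (Suc n)
    have rec: "of_nat (Suc n) * H $ Suc n = K * H $ n" if "fps_deriv H = fps_const K * H" for H :: "'a fps"
      using arg_cong[OF that, of "\<lambda>F. F $ n"] by simp
    show ?case
      by (rule of_nat_cancel[of n]) (simp only: rec[OF assms(1)] rec[OF assms(2)] Suc)
  qed (rule assms(3))
qed

text \<open>The formula \<open>exp (t y) w = (exp (t ad y) w) exp (t y)\<close>, where \<open>w i\<close> is the \<open>i\<close>-th iterate of \<open>ad y\<close> on
  \<open>w 0\<close>. Both sides solve \<open>F' = y F\<close>: for the right-hand side this holds because the commutator of \<open>y\<close> with
  \<open>exp (t ad y) w\<close> is the derivative of the latter.\<close>

lemma gexp_conj: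
  assumes "\<And>i. y * w i = w i * y + w (Suc i)"
  shows "gexp y * fps_const (w 0) = Abs_fps (\<lambda>i. sc (1 / fact i) * w i) * gexp y"
proof (rule ode_unique[where K = y])
  let ?W = "Abs_fps (\<lambda>i. sc (1 / fact i) * w i)"
  have d: "fps_deriv ?W = Abs_fps (\<lambda>i. sc (1 / fact i) * w (Suc i))"
  proof (rule fps_ext)
    fix n
    have "of_nat (Suc n) * (1 / fact (Suc n)) = (1 / fact n :: 'f)"
      by (simp add: field_simps del: of_nat_Suc)
    then show "fps_deriv ?W $ n = Abs_fps (\<lambda>i. sc (1 / fact i) * w (Suc i)) $ n"
      using sc_sc[of "of_nat (Suc n)" "1 / fact (Suc n)" "w (Suc n)"]
      by (simp add: sc_of_nat[symmetric] del: of_nat_Suc)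
  qed
  have c: "fps_const y * ?W = ?W * fps_const y + fps_deriv ?W"
    unfolding d by (rule fps_ext) (simp add: sc_left_commute assms distrib_left mult.assoc)
  show "fps_deriv (gexp y * fps_const (w 0)) = fps_const y * (gexp y * fps_const (w 0))"
    by (simp add: deriv_gexp mult.assoc)
  show "fps_deriv (?W * gexp y) = fps_const y * (?W * gexp y)"
    by (simp add: deriv_gexp c distrib_right mult.assoc flip: mult.assoc[of "fps_const y"])
qed simp

lemma gexp_add:
  assumes "a * b = b * a"
  shows "gexp (a + b) = gexp a * gexp b"
proof (rule ode_unique[where K = "a + b"])
  have c: "fps_const b * gexp a = gexp a * fps_const b"
    by (rule fps_const_commuteI) (simp add: assms divpow_commute)
  show "fps_deriv (gexp a * gexp b) = fps_const (a + b) * (gexp a * gexp b)"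
    by (simp add: deriv_gexp distrib_right c add.commute mult.assoc flip: fps_const_add mult.assoc[of "fps_const b"])
qed (simp_all add: deriv_gexp)

text \<open>The series \<open>exp (t\<^sup>2 d)\<close>.\<close>

definition gexp_square :: "'a \<Rightarrow> 'a fps" where
  "gexp_square d = Abs_fps (\<lambda>n. if even n then divpow d (n div 2) else 0)"

lemma deriv_gexp_square: "fps_deriv (gexp_square d) = fps_X * fps_const (2 * d) * gexp_square d"
proof (rule fps_ext)
  fix n
  show "fps_deriv (gexp_square d) $ n = (fps_X * fps_const (2 * d) * gexp_square d) $ n"
  proof (cases n)
    case (Suc m)
    show ?thesis
    proof (cases "even m")
      case True
      then obtain k where k: "m = 2 * k" by auto
      have "of_nat (2 * Suc k) * divpow d (Suc k) = 2 * (d * divpow d k)"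
        using divpow_Suc[of k d] by (simp only: of_nat_mult mult.assoc of_nat_numeral)
      then show ?thesis by (simp add: Suc k gexp_square_def mult.assoc)
    qed (simp add: Suc gexp_square_def mult.assoc)
  qed (simp add: gexp_square_def mult.assoc)
qed

text \<open>The Baker-Campbell-Hausdorff formula for a central commutator \<open>[a, b] = 2 d\<close>. The derivative of the
  right-hand side contains \<open>exp (t b) a\<close>; moving \<open>a\<close> to the left produces \<open>- 2 t d\<close>, which the derivative
  \<open>2 t d\<close> of the exponent \<open>t\<^sup>2 d\<close> cancels. Writing the commutator as \<open>2 d\<close> avoids halving.\<close>

lemma gexp_add_heisenberg:
  assumes ab: "a * b = b * a + 2 * d" and da: "d * a = a * d" and db: "d * b = b * d"
  shows "gexp (a + b) = gexp_square d * gexp b * gexp a"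
proof (rule ode_unique[where K = "a + b"])
  let ?w = "\<lambda>i. if i = 0 then a else if i = 1 then - (2 * d) else 0"
  have "Abs_fps (\<lambda>i. sc (1 / fact i) * ?w i) = fps_const a - fps_X * fps_const (2 * d)"
    by (rule fps_ext) (auto simp: fps_X_def)
  moreover have "b * ?w i = ?w i * b + ?w (Suc i)" for i
    using ab db by (auto simp: algebra_simps mult_2 mult_2_right)
  ultimately have conj: "gexp b * fps_const a = (fps_const a - fps_X * fps_const (2 * d)) * gexp b"
    using gexp_conj[of b ?w] by simp
  have ga: "fps_const a * gexp_square d = gexp_square d * fps_const a"
    and gb: "fps_const b * gexp_square d = gexp_square d * fps_const b"
    by (rule fps_const_commuteI, simp add: gexp_square_def divpow_commute da db)+
  have gd: "fps_const (2 * d) * gexp_square d = gexp_square d * fps_const (2 * d)"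
    by (rule fps_const_commuteI) (simp add: gexp_square_def mult_2 mult_2_right distrib_left distrib_right divpow_commute)
  have gx: "fps_X * fps_const (2 * d) * gexp_square d = gexp_square d * (fps_X * fps_const (2 * d))"
    using gd by (metis fps_mult_fps_X_commute mult.assoc)
  have gx': "fps_X * (fps_const (2 * d) * (gexp_square d * z)) = gexp_square d * (fps_X * (fps_const (2 * d) * z))" for z
    using arg_cong[OF gx, of "\<lambda>u. u * z"] by (simp only: mult.assoc)
  let ?G = "gexp_square d * gexp b * gexp a"
  have "fps_deriv ?G = gexp_square d * (gexp b * fps_const a) * gexp a + gexp_square d * fps_const b * gexp b * gexp a
      + fps_X * fps_const (2 * d) * gexp_square d * gexp b * gexp a"
    by (simp add: deriv_gexp deriv_gexp_square distrib_right distrib_left mult.assoc)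
  also have "\<dots> = gexp_square d * fps_const a * gexp b * gexp a + gexp_square d * fps_const b * gexp b * gexp a"
    by (simp add: conj gx' algebra_simps)
  also have "\<dots> = fps_const (a + b) * ?G"
    by (simp add: ga[symmetric] gb[symmetric] distrib_right mult.assoc flip: fps_const_add)
  finally show "fps_deriv ?G = fps_const (a + b) * ?G" .
qed (simp_all add: deriv_gexp gexp_square_def)

lemma fps_family_gexp: "fps_family (gexp a) (\<lambda>n. n) (divpow a)"
  by (simp add: fps_family_def)

lemma fps_family_gexp_square: "fps_family (gexp_square d) (\<lambda>k. 2 * k) (divpow d)"
  unfolding fps_family_def
proof (intro allI conjI)
  fix n :: nat
  show "finite {k. 2 * k = n}" by (rule finite_subset[of _ "{..n}"]) auto
  have "{k. 2 * k = n} = (if even n then {n div 2} else {})" by auto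
  then show "gexp_square d $ n = (\<Sum>k | 2 * k = n. divpow d k)" by (simp add: gexp_square_def)
qed

lemma divpow_binomial:
  assumes "a * b = b * a"
  shows "divpow (a + b) n = (\<Sum>i=0..n. divpow b i * divpow a (n - i))"
  using gexp_add[of b a] assms by (simp add: add.commute fps_mult_nth flip: gexp_nth)

lemma divpow_trinomial:
  assumes "a * b = b * a" "a * c = c * a" "b * c = c * b"
  shows "divpow (a + b + c) n = (\<Sum>(i, j)\<in>{(i, j). i + j \<le> n}. divpow b i * divpow c j * divpow a (n - i - j))"
proof -
  have "gexp (a + b + c) = gexp b * (gexp c * gexp a)"
    using gexp_add[of b "c + a"] gexp_add[of c a] assms by (simp add: algebra_simps)
  then have fam: "fps_family (gexp (a + b + c)) (\<lambda>(i, j, k). i + (j + k)) (\<lambda>(i, j, k). divpow b i * (divpow c j * divpow a k))"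
    using fps_family_mult[OF fps_family_gexp[of b] fps_family_mult[OF fps_family_gexp[of c] fps_family_gexp[of a]]]
    by (simp add: case_prod_unfold)
  have "divpow (a + b + c) n = (\<Sum>(i, j, k) | i + (j + k) = n. divpow b i * (divpow c j * divpow a k))"
    using fam by (simp add: fps_family_def case_prod_unfold)
  also have "\<dots> = (\<Sum>(i, j)\<in>{(i, j). i + j \<le> n}. divpow b i * divpow c j * divpow a (n - i - j))"
    by (rule sum.reindex_bij_witness[of _ "\<lambda>(i, j). (i, j, n - i - j)" "\<lambda>(i, j, k). (i, j)"])
       (auto simp: mult.assoc)
  finally show ?thesis .
qed

text \<open>Up to commuting factors, the order is that of the final normal form, with \<open>b\<close> in the role of \<open>x\<^sub>3\<close>, \<open>a\<close> of \<open>x\<^sub>4\<close>, \<open>c\<close> of \<open>x\<^sub>2\<close>,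
  and \<open>d, e\<close> of \<open>x\<^sub>1\<close>. The index \<open>g4\<close> has weight \<open>2\<close> since it belongs to \<open>exp (t\<^sup>2 d)\<close>.\<close>

lemma divpow_heisenberg:
  assumes ab: "a * b = b * a + 2 * d" and d: "d * a = a * d" "d * b = b * d"
    and c: "c * a = a * c" "c * b = b * c" "c * e = e * c"
    and e: "e * a = a * e" "e * b = b * e"
  shows "divpow (a + b + c + e) n =
    (\<Sum>(g1, g2, g3, g4)\<in>{(g1, g2, g3, g4). g1 + g2 + g3 + 2 * g4 \<le> n}.
       divpow e g3 * divpow c g2 * divpow d g4 * divpow b g1 * divpow a (n - g1 - g2 - g3 - 2 * g4))"
proof -
  have "gexp (a + b + c + e) = gexp e * (gexp c * (gexp_square d * (gexp b * gexp a)))"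
    using gexp_add[of e "c + (a + b)"] gexp_add[of c "a + b"] gexp_add_heisenberg[OF ab d] c e
    by (simp add: algebra_simps)
  then have fam: "fps_family (gexp (a + b + c + e)) (\<lambda>(g3, g2, g4, g1, g0). g3 + (g2 + (2 * g4 + (g1 + g0))))
      (\<lambda>(g3, g2, g4, g1, g0). divpow e g3 * (divpow c g2 * (divpow d g4 * (divpow b g1 * divpow a g0))))"
    using fps_family_mult[OF fps_family_gexp[of e] fps_family_mult[OF fps_family_gexp[of c]
        fps_family_mult[OF fps_family_gexp_square[of d] fps_family_mult[OF fps_family_gexp[of b] fps_family_gexp[of a]]]]]
    by (simp add: case_prod_unfold)
  have "divpow (a + b + c + e) n = (\<Sum>(g3, g2, g4, g1, g0) | g3 + (g2 + (2 * g4 + (g1 + g0))) = n.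
      divpow e g3 * (divpow c g2 * (divpow d g4 * (divpow b g1 * divpow a g0))))"
    using fam by (simp add: fps_family_def case_prod_unfold)
  also have "\<dots> = (\<Sum>(g1, g2, g3, g4)\<in>{(g1, g2, g3, g4). g1 + g2 + g3 + 2 * g4 \<le> n}.
       divpow e g3 * divpow c g2 * divpow d g4 * divpow b g1 * divpow a (n - g1 - g2 - g3 - 2 * g4))"
    by (rule sum.reindex_bij_witness[of _
          "\<lambda>(g1, g2, g3, g4). (g3, g2, g4, g1, n - g1 - g2 - g3 - 2 * g4)"
          "\<lambda>(g3, g2, g4, g1, g0). (g1, g2, g3, g4)"])
       (auto simp: mult.assoc)
  finally show ?thesis .
qed

text \<open>The expansions of divided powers are needed for series in \<open>t\<close>, that is, for the ring of power
  series instead of the ring itself.\<close>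

lemma central_scalars_fps: "central_scalars (\<lambda>c. fps_const (sc c))"
proof
  fix F :: "'a fps" and c :: 'f
  show "F * fps_const (sc c) = fps_const (sc c) * F"
    by (rule fps_const_commuteI[symmetric]) (rule sc_central[symmetric])
qed (simp_all add: sc_add sc_mult)

abbreviation divpow_fps :: "'a fps \<Rightarrow> nat \<Rightarrow> 'a fps" where
  "divpow_fps \<equiv> central_scalars.divpow (\<lambda>c. fps_const (sc c))"

lemma divpow_fps_eq: "divpow_fps x n = fps_const (sc (1 / fact n)) * x ^ n"
  by (rule central_scalars.divpow_def[OF central_scalars_fps])

lemma divpow_fps_const: "divpow_fps (fps_const a) n = fps_const (divpow a n)"
  by (simp add: divpow_fps_eq divpow_def)

lemma divpow_fps_monomial: "divpow_fps (fps_X ^ i * fps_const b) n = fps_X ^ (i * n) * fps_const (divpow b n)"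
proof -
  have "(fps_X ^ i * fps_const b) ^ n = (fps_X ^ (i * n) * fps_const (b ^ n) :: 'a fps)"
    by (induction n) (simp_all only: power_Suc fps_monomial_mult, simp_all)
  then show ?thesis
    using fps_monomial_mult[of 0 "sc (1 / fact n)" "i * n" "b ^ n"] by (simp add: divpow_fps_eq divpow_def)
qed

text \<open>Conjugation by \<open>E\<close> is multiplicative, so that it maps divided powers to divided powers.\<close>

lemma divpow_fps_conj:
  assumes "E * fps_const w = W * E"
  shows "E * fps_const (divpow w n) = divpow_fps W n * E"
proof -
  have "E * fps_const (w ^ n) = W ^ n * E"
  proof (induction n)
    case (Suc n)
    have "E * fps_const (w ^ Suc n) = E * fps_const w * fps_const (w ^ n)"
      by (simp add: mult.assoc)
    also have "\<dots> = W ^ Suc n * E"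
      by (simp add: assms mult.assoc Suc)
    finally show ?case .
  qed simp
  moreover have "E * fps_const (divpow w n) = fps_const (sc (1 / fact n)) * (E * fps_const (w ^ n))"
    using central_scalars.sc_left_commute[OF central_scalars_fps, of E "1 / fact n" "fps_const (w ^ n)"]
    by (simp add: divpow_def)
  ultimately show ?thesis by (simp add: divpow_fps_eq mult.assoc)
qed

text \<open>Three iterates suffice: \<open>ad x\<^sub>5\<close> maps \<open>x\<^sub>4\<close> via \<open>- x\<^sub>3\<close> and \<open>x\<^sub>2\<close> to \<open>- x\<^sub>1\<close>, and that to \<open>0\<close>.\<close>

lemma gexp_conj_truncated:
  assumes w: "y * w0 = w0 * y + w1" "y * w1 = w1 * y + w2" "y * w2 = w2 * y + w3" "y * w3 = w3 * y"
  shows "gexp y * fps_const w0 = (fps_const w0 + fps_X ^ 1 * fps_const w1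
    + fps_X ^ 2 * fps_const (sc (1 / 2) * w2) + fps_X ^ 3 * fps_const (sc (1 / 6) * w3)) * gexp y"
proof -
  let ?w = "\<lambda>i. if i = 0 then w0 else if i = 1 then w1 else if i = 2 then w2 else if i = 3 then w3 else 0"
  have "y * ?w i = ?w i * y + ?w (Suc i)" for i
    using w by (simp add: numeral_eq_Suc)
  moreover have "Abs_fps (\<lambda>i. sc (1 / fact i) * ?w i) = fps_const w0 + fps_X ^ 1 * fps_const w1
    + fps_X ^ 2 * fps_const (sc (1 / 2) * w2) + fps_X ^ 3 * fps_const (sc (1 / 6) * w3)"
    by (rule fps_ext) (auto simp: fps_X_power_mult_nth fact_numeral numeral_eq_Suc)
  ultimately show ?thesis using gexp_conj[of y ?w] by simp
qed

text \<open>Reordering in the Heisenberg algebra. It is the coefficient of \<open>t\<^sup>m\<close> in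
  \<open>exp (t y) x\<^sup>n = (x - t c)\<^sup>n exp (t y)\<close>.\<close>

lemma divpow_swap:
  assumes "y * x = x * y - c" "y * c = c * y" "x * c = c * x"
  shows "divpow y m * divpow x n = (\<Sum>i=0..min m n. divpow (sc (- 1) * c) i * divpow x (n - i) * divpow y (m - i))"
proof -
  interpret T: central_scalars "\<lambda>c. fps_const (sc c)" by (rule central_scalars_fps)
  let ?c = "sc (- 1) * c"
  let ?W = "fps_const x + fps_X ^ 1 * fps_const ?c"
  have c: "?c = - c" by (simp add: sc_minus)
  have conj: "gexp y * fps_const x = ?W * gexp y"
    using gexp_conj_truncated[of y x ?c 0 0] assms by (simp add: c)
  have comm: "fps_const x * (fps_X ^ 1 * fps_const ?c) = fps_X ^ 1 * fps_const ?c * fps_const x"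
    by (rule fps_const_monomial_commute) (simp add: c assms)
  have W: "divpow_fps ?W n = (\<Sum>i\<in>{0..n}. fps_X ^ i * fps_const (divpow ?c i * divpow x (n - i)))"
    unfolding T.divpow_binomial[OF comm] divpow_fps_monomial divpow_fps_const by (simp add: mult.assoc)
  have "divpow y m * divpow x n = (gexp y * fps_const (divpow x n)) $ m" by simp
  also have "\<dots> = (divpow_fps ?W n * gexp y) $ m" by (simp only: divpow_fps_conj[OF conj])
  also have "\<dots> = (\<Sum>i | i \<in> {0..n} \<and> i \<le> m. divpow ?c i * divpow x (n - i) * divpow y (m - i))"
    unfolding W by (subst sum_monomials_mult_nth) auto
  also have "{i. i \<in> {0..n} \<and> i \<le> m} = {0..min m n}" by auto
  finally show ?thesis .
qed

end

section \<open>Reordering monomials\<close>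

lemma power_power_commute: "x * y = y * x \<Longrightarrow> x ^ a * y ^ b = y ^ b * (x ^ a :: 'a::monoid_mult)"
  by (metis power_commuting_commutes)

lemma power_power_left_commute: "x * y = y * x \<Longrightarrow> x ^ a * (y ^ b * z) = y ^ b * (x ^ a * (z :: 'a::monoid_mult))"
  by (metis power_power_commute mult.assoc)

lemma power_merge: "x ^ a * x ^ b = (x ^ (a + b) :: 'a::monoid_mult)" "x ^ a * (x ^ b * z) = x ^ (a + b) * (z :: 'a::monoid_mult)"
  by (simp_all add: power_add mult.assoc)

definition reorder_coeff ::
  "nat \<Rightarrow> nat \<Rightarrow> nat \<Rightarrow> nat \<Rightarrow> nat \<Rightarrow> nat \<Rightarrow> nat \<Rightarrow> nat \<Rightarrow> nat \<Rightarrow> nat \<Rightarrow> nat \<Rightarrow> nat \<Rightarrow> nat \<Rightarrow> 'f::field_char_0" where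
  "reorder_coeff m n q r s a b1 b2 g1 g2 g3 g4 d =
     of_nat (n choose a) * of_nat (q choose a)
     * of_nat (r choose (b1 + b2)) * of_nat ((n - a) choose (b1 + 2 * b2))
     * of_nat ((b1 + b2) choose b1)
     * of_nat (s choose (g1 + g2 + g3 + 2 * g4))
     * of_nat ((n - a - b1 - 2 * b2) choose (g1 + 2 * g2 + 3 * g3 + g4))
     * of_nat (m choose d) * of_nat ((r - b1 - b2 + g1) choose d)
     * fact a * (fact (b1 + 2 * b2) / 2 ^ b2)
     * (fact (g1 + g2 + g3 + 2 * g4) * fact (g1 + 2 * g2 + 3 * g3 + g4)
        / (fact 2 ^ (g2 + g4) * fact 3 ^ g3 * fact g4 * fact g3 * fact g2 * fact g1))
     * fact d * (- 1) ^ (a + b1 + g1 + g3 + d)"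

text \<open>The left-hand side is the coefficient as the expansions yield it: \<open>n! q! r! s!\<close> for passing to divided
  powers, one factor for each divided power, and the contribution of moving \<open>x\<^sub>4\<^sup>m\<close> past a power of \<open>x\<^sub>3\<close>.
  Each of the binomial coefficients on the right is a quotient of factorials, since its arguments
  are in range, and the intermediate factorials cancel.\<close>

lemma reorder_coeff_eq:
  assumes "a \<le> n" "a \<le> q" "b1 + b2 \<le> r" "b1 + 2 * b2 \<le> n - a"
    and "g1 + g2 + g3 + 2 * g4 \<le> s" "g1 + 2 * g2 + 3 * g3 + g4 \<le> n - a - (b1 + 2 * b2)"
    and "d \<le> m" "d \<le> r - b1 - b2 + g1"
  shows "fact n * fact q * fact r * fact s * ((- 1) ^ a / fact a) * (1 / fact (q - a)) * ((- 1) ^ b1 / fact b1) *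
       ((1 / 2) ^ b2 / fact b2) * (1 / fact (r - b1 - b2)) *
       ((- 1 / 6) ^ g3 / fact g3) * ((1 / 2) ^ g2 / fact g2) * ((1 / 2) ^ g4 / fact g4) * ((- 1) ^ g1 / fact g1) *
       (1 / fact (s - g1 - g2 - g3 - 2 * g4)) * (1 / fact (n - a - (b1 + 2 * b2) - (g1 + 2 * g2 + 3 * g3 + g4))) *
       (fact m * fact (r - b1 - b2 + g1) * ((- 1) ^ d / fact d * (1 / fact (r - b1 - b2 + g1 - d) * (1 / fact (m - d))))) =
     (reorder_coeff m n q r s a b1 b2 g1 g2 g3 g4 d :: 'f::field_char_0)"
proof -
  define N1 N2 T where "N1 = n - a" "N2 = n - a - b1 - 2 * b2" "T = g1 + 2 * g2 + 3 * g3 + g4"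
  define S R where "S = g1 + g2 + g3 + 2 * g4" "R = r - b1 - b2 + g1"
  have sub: "n - a - (b1 + 2 * b2) = N2" "N1 - (b1 + 2 * b2) = N2" "N1 - b1 - 2 * b2 = N2"
     "s - g1 - g2 - g3 - 2 * g4 = s - S" "r - (b1 + b2) = r - b1 - b2" "b1 + b2 - b1 = b2"
    by (simp_all add: N1_N2_T_def S_R_def)
  have le: "a \<le> n" "a \<le> q" "b1 + b2 \<le> r" "b1 + 2 * b2 \<le> N1" "S \<le> s" "T \<le> N2" "d \<le> m" "d \<le> R" "b1 \<le> b1 + b2"
    using assms by (simp_all add: N1_N2_T_def S_R_def)
  have pw: "(- 1 / 6) ^ g3 = (- 1) ^ g3 / (6 ^ g3 :: 'f)" "(1 / 2) ^ i = 1 / (2 ^ i :: 'f)" for i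
    by (simp_all only: power_divide power_one)
  have f: "fact 2 = (2::'f)" "fact 3 = (6::'f)" by (simp_all add: fact_numeral)
  show ?thesis
    unfolding reorder_coeff_def f pw power_add N1_N2_T_def(1)[symmetric] N1_N2_T_def(2)[symmetric]
      N1_N2_T_def(3)[symmetric] S_R_def[symmetric] sub binomial_fact[OF le(1)] binomial_fact[OF le(2)]
      binomial_fact[OF le(3)] binomial_fact[OF le(4)] binomial_fact[OF le(5)] binomial_fact[OF le(6)]
      binomial_fact[OF le(7)] binomial_fact[OF le(8)] binomial_fact[OF le(9)]
    by simp (simp add: divide_simps)
qed

text \<open>The relations of the enveloping algebra, in the form in which they reorder products.\<close>

locale n56_relations = central_scalars sc for sc :: "'f::field_char_0 \<Rightarrow> 'a::ring_1" +
  fixes y1 y2 y3 y4 y5 :: 'a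
  assumes y43: "y4 * y3 = y3 * y4 - y1"
    and y52: "y5 * y2 = y2 * y5 - y1"
    and y53: "y5 * y3 = y3 * y5 - y2"
    and y54: "y5 * y4 = y4 * y5 - y3"
    and y21: "y2 * y1 = y1 * y2"
    and y31: "y3 * y1 = y1 * y3"
    and y41: "y4 * y1 = y1 * y4"
    and y51: "y5 * y1 = y1 * y5"
    and y32: "y3 * y2 = y2 * y3"
    and y42: "y4 * y2 = y2 * y4"
begin

text \<open>The coefficient of \<open>t\<^sup>n\<close> in \<open>exp (t x\<^sub>5) x\<^sub>2\<^sup>q x\<^sub>3\<^sup>r x\<^sub>4\<^sup>s = A\<^sub>2\<^sup>q A\<^sub>3\<^sup>r A\<^sub>4\<^sup>s exp (t x\<^sub>5)\<close>, where \<open>A\<^sub>i\<close> is the conjugate of \<open>x\<^sub>i\<close>.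
  The three powers are peeled off from the left, and each takes its share of the exponent \<open>n\<close>; this is why
  the bounds for \<open>\<beta>\<close> and \<open>\<gamma>\<close> are nested.\<close>

lemma divpow_reorder:
  "divpow y5 n * (divpow y2 q * divpow y3 r * divpow y4 s) =
    (\<Sum>a=0..min n q. \<Sum>(b1, b2)\<in>{(b1, b2). b1 + b2 \<le> r \<and> b1 + 2 * b2 \<le> n - a}.
      \<Sum>(g1, g2, g3, g4)\<in>{(g1, g2, g3, g4). g1 + g2 + g3 + 2 * g4 \<le> s \<and>
             g1 + 2 * g2 + 3 * g3 + g4 \<le> n - a - (b1 + 2 * b2)}.
        (divpow (sc (- 1) * y1) a * divpow y2 (q - a)) *
        ((divpow (sc (- 1) * y2) b1 * divpow (sc (1 / 2) * y1) b2 * divpow y3 (r - b1 - b2)) *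
        ((divpow (sc (- 1 / 6) * y1) g3 * divpow (sc (1 / 2) * y2) g2 * divpow (sc (1 / 2) * y1) g4 *
          divpow (sc (- 1) * y3) g1 * divpow y4 (s - g1 - g2 - g3 - 2 * g4)) *
        divpow y5 (n - a - (b1 + 2 * b2) - (g1 + 2 * g2 + 3 * g3 + g4)))))"
proof -
  interpret T: central_scalars "\<lambda>c. fps_const (sc c)" by (rule central_scalars_fps)
  let ?m = "\<lambda>i c y. fps_X ^ i * fps_const (sc c * y) :: 'a fps"
  define A2 where "A2 = fps_const y2 + ?m 1 (- 1) y1"
  define A3 where "A3 = fps_const y3 + ?m 1 (- 1) y2 + ?m 2 (1 / 2) y1"
  define A4 where "A4 = fps_const y4 + ?m 1 (- 1) y3 + ?m 2 (1 / 2) y2 + ?m 3 (- 1 / 6) y1"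
  have neg: "sc (- 1) * x = - x" for x by (simp add: sc_minus)
  have c2: "gexp y5 * fps_const y2 = A2 * gexp y5"
    using gexp_conj_truncated[of y5 y2 "- y1" 0 0] y52 y51 by (simp add: A2_def neg)
  have c3: "gexp y5 * fps_const y3 = A3 * gexp y5"
    using gexp_conj_truncated[of y5 y3 "- y2" y1 0] y53 y52 y51 by (simp add: A3_def neg)
  have c4: "gexp y5 * fps_const y4 = A4 * gexp y5"
    using gexp_conj_truncated[of y5 y4 "- y3" y2 "- y1"] y54 y53 y52 y51
    by (simp add: A4_def neg sc_minus)
  note y_comms = y21 y31 y41 y32 y42 y21[symmetric] y31[symmetric] y41[symmetric] y32[symmetric] y42[symmetric]
    refl[of "y1 * y1"]
  note sc_comms = y_comms y_comms[THEN scaled_commute(1)] y_comms[THEN scaled_commute(2)] y_comms[THEN scaled_commute(3)]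
  note comms = sc_comms[THEN fps_monomial_commute] sc_comms[THEN fps_const_monomial_commute(1)]
    sc_comms[THEN fps_const_monomial_commute(2)] sc_comms[THEN fps_const_monomial_commute(3)]
  note monomial = divpow_fps_monomial divpow_fps_const fps_monomial_mult fps_monomial_const_mult
  have E2: "divpow_fps A2 q = (\<Sum>a\<in>{0..q}. fps_X ^ a * fps_const (divpow (sc (- 1) * y1) a * divpow y2 (q - a)))"
    unfolding A2_def
    by (subst T.divpow_binomial, (rule comms)+) (simp only: monomial mult_1)
  have E3: "divpow_fps A3 r = (\<Sum>b\<in>{(b1, b2). b1 + b2 \<le> r}. fps_X ^ (case b of (b1, b2) \<Rightarrow> b1 + 2 * b2) *
      fps_const (case b of (b1, b2) \<Rightarrow> divpow (sc (- 1) * y2) b1 * divpow (sc (1 / 2) * y1) b2 * divpow y3 (r - b1 - b2)))"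
    unfolding A3_def
    by (subst T.divpow_trinomial, (rule comms)+) (simp only: monomial case_prod_unfold mult_1 mult.commute)
  have E4: "divpow_fps A4 s = (\<Sum>g\<in>{(g1, g2, g3, g4). g1 + g2 + g3 + 2 * g4 \<le> s}.
      fps_X ^ (case g of (g1, g2, g3, g4) \<Rightarrow> g1 + 2 * g2 + 3 * g3 + g4) *
      fps_const (case g of (g1, g2, g3, g4) \<Rightarrow>
         divpow (sc (- 1 / 6) * y1) g3 * divpow (sc (1 / 2) * y2) g2 * divpow (sc (1 / 2) * y1) g4 *
          divpow (sc (- 1) * y3) g1 * divpow y4 (s - g1 - g2 - g3 - 2 * g4)))"
  proof -
    \<comment> \<open>The commutator of \<open>x\<^sub>4\<close> and \<open>- t x\<^sub>3\<close> is \<open>t x\<^sub>1\<close>.\<close>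
    have h: "fps_const y4 * ?m 1 (- 1) y3 = ?m 1 (- 1) y3 * fps_const y4 + 2 * ?m 1 (1 / 2) y1"
    proof -
      have "fps_const y4 * ?m 1 (- 1) y3 = fps_X ^ 1 * fps_const (y4 * (sc (- 1) * y3))"
        using fps_monomial_mult[of 0 y4 1 "sc (- 1) * y3"] by simp
      also have "y4 * (sc (- 1) * y3) = (sc (- 1) * y3) * y4 + y1"
        by (simp add: neg y43)
      also have "y1 = sc (1 / 2) * y1 + sc (1 / 2) * y1"
        by (simp flip: distrib_right sc_add)
      finally show ?thesis
        by (simp add: distrib_left mult_2 mult.assoc flip: fps_const_add)
    qed
    show ?thesis
      unfolding A4_def
      by (subst T.divpow_heisenberg[OF h], (rule comms)+) (simp only: monomial case_prod_unfold mult_1 add.commute add.left_commute add.assoc mult.commute)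
  qed
  have f3: "finite {(b1, b2). b1 + b2 \<le> r}"
    by (rule finite_subset[of _ "{..r} \<times> {..r}"]) auto
  have f4: "finite {(g1, g2, g3, g4). g1 + g2 + g3 + 2 * g4 \<le> s}"
    by (rule finite_subset[of _ "{..s} \<times> {..s} \<times> {..s} \<times> {..s}"]) auto
  have "divpow y5 n * (divpow y2 q * divpow y3 r * divpow y4 s) =
      (gexp y5 * fps_const (divpow y2 q) * fps_const (divpow y3 r) * fps_const (divpow y4 s)) $ n"
    by (simp add: mult.assoc)
  also have "gexp y5 * fps_const (divpow y2 q) * fps_const (divpow y3 r) * fps_const (divpow y4 s) =
      divpow_fps A2 q * (divpow_fps A3 r * (divpow_fps A4 s * gexp y5))"
    by (simp add: divpow_fps_conj[OF c2] divpow_fps_conj[OF c3] divpow_fps_conj[OF c4] mult.assoc)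
  also have "(divpow_fps A2 q * (divpow_fps A3 r * (divpow_fps A4 s * gexp y5))) $ n =
     (\<Sum>a | a \<in> {0..q} \<and> a \<le> n. (divpow (sc (- 1) * y1) a * divpow y2 (q - a)) * (divpow_fps A3 r * (divpow_fps A4 s * gexp y5)) $ (n - a))"
    unfolding E2 by (subst sum_monomials_mult_nth) auto
  also have "{a. a \<in> {0..q} \<and> a \<le> n} = {0..min n q}" by auto
  finally have expand2: "divpow y5 n * (divpow y2 q * divpow y3 r * divpow y4 s) =
    (\<Sum>a=0..min n q. (divpow (sc (- 1) * y1) a * divpow y2 (q - a)) * (divpow_fps A3 r * (divpow_fps A4 s * gexp y5)) $ (n - a))" .
  have expand3: "(divpow_fps A3 r * F) $ N = (\<Sum>(b1, b2)\<in>{(b1, b2). b1 + b2 \<le> r \<and> b1 + 2 * b2 \<le> N}.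
      (divpow (sc (- 1) * y2) b1 * divpow (sc (1 / 2) * y1) b2 * divpow y3 (r - b1 - b2)) * F $ (N - (b1 + 2 * b2)))" for F N
    unfolding E3 by (subst sum_monomials_mult_nth[OF f3]) (rule sum.cong, auto)
  have expand4: "(divpow_fps A4 s * F) $ N = (\<Sum>(g1, g2, g3, g4)\<in>{(g1, g2, g3, g4). g1 + g2 + g3 + 2 * g4 \<le> s \<and>
        g1 + 2 * g2 + 3 * g3 + g4 \<le> N}.
      (divpow (sc (- 1 / 6) * y1) g3 * divpow (sc (1 / 2) * y2) g2 * divpow (sc (1 / 2) * y1) g4 *
          divpow (sc (- 1) * y3) g1 * divpow y4 (s - g1 - g2 - g3 - 2 * g4)) * F $ (N - (g1 + 2 * g2 + 3 * g3 + g4)))" for F N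
    unfolding E4 by (subst sum_monomials_mult_nth[OF f4]) (rule sum.cong, auto)
  show ?thesis
    unfolding expand2 expand3 expand4 by (simp only: sum_distrib_left case_prod_unfold gexp_nth)
qed

definition pbw :: "nat \<Rightarrow> nat \<Rightarrow> nat \<Rightarrow> nat \<Rightarrow> nat \<Rightarrow> 'a" where
  "pbw a b c d e = y1 ^ a * y2 ^ b * y3 ^ c * y4 ^ d * y5 ^ e"

lemma pbw_cong: "a = a' \<Longrightarrow> b = b' \<Longrightarrow> c = c' \<Longrightarrow> d = d' \<Longrightarrow> e = e' \<Longrightarrow> pbw a b c d e = pbw a' b' c' d' e'"
  by simp

lemmas y_comms = y21 y31 y41 y51 y32 y42

text \<open>Rewrite rules that bring a product of powers into the order \<open>y1, y2, y3, y4, y5\<close>, with all scalars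
  collected in front. The pairs \<open>(y4, y3)\<close> and \<open>(y5, y2)\<close>, \<open>(y5, y3)\<close>, \<open>(y5, y4)\<close>, which need not commute, are left alone.\<close>

lemmas sort_powers = mult.assoc y_comms[THEN power_power_commute] y_comms[THEN power_power_left_commute]
  power_merge sc_sc sc_left_commute[of "y1 ^ _"] sc_left_commute[of "y2 ^ _"] sc_left_commute[of "y3 ^ _"]
  sc_left_commute[of "y4 ^ _"] sc_left_commute[of "y5 ^ _"]

lemma power_swap:
  "y4 ^ m * y3 ^ R = (\<Sum>d=0..min m R.
     sc (fact m * fact R * ((- 1) ^ d / fact d * (1 / fact (R - d) * (1 / fact (m - d))))) * (y1 ^ d * (y3 ^ (R - d) * y4 ^ (m - d))))"
proof -
  have "y4 ^ m * y3 ^ R = sc (fact m * fact R) * (divpow y4 m * divpow y3 R)"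
    by (simp only: power_eq_divpow scaled_mult)
  also have "divpow y4 m * divpow y3 R = (\<Sum>d=0..min m R. divpow (sc (- 1) * y1) d * divpow y3 (R - d) * divpow y4 (m - d))"
    by (rule divpow_swap) (simp_all add: y43 y41 y31)
  also have "sc (fact m * fact R) * \<dots> = (\<Sum>d=0..min m R.
     sc (fact m * fact R * ((- 1) ^ d / fact d * (1 / fact (R - d) * (1 / fact (m - d))))) * (y1 ^ d * (y3 ^ (R - d) * y4 ^ (m - d))))"
    unfolding sum_distrib_left
  proof (rule sum.cong[OF refl])
    fix d
    show "sc (fact m * fact R) * (divpow (sc (- 1) * y1) d * divpow y3 (R - d) * divpow y4 (m - d)) =
       sc (fact m * fact R * ((- 1) ^ d / fact d * (1 / fact (R - d) * (1 / fact (m - d))))) *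
         (y1 ^ d * (y3 ^ (R - d) * y4 ^ (m - d)))"
      unfolding divpow_scaled unfolding divpow_def by (simp only: sort_powers mult_ac)
  qed
  finally show ?thesis .
qed

text \<open>A single summand of \<open>divpow_reorder\<close>, multiplied by the outer factors of the two monomials. Everything
  is in order up to commuting factors, except that \<open>y4 ^ m\<close> still has to pass \<open>y3 ^ (rb + g1)\<close>.\<close>

lemma reorder_term:
  "sc K * (y1 ^ J * (y2 ^ k * (y3 ^ l * (y4 ^ m * (((divpow (sc (- 1) * y1) a * divpow y2 qa) *
        ((divpow (sc (- 1) * y2) b1 * divpow (sc (1 / 2) * y1) b2 * divpow y3 rb) *
        ((divpow (sc (- 1 / 6) * y1) g3 * divpow (sc (1 / 2) * y2) g2 * divpow (sc (1 / 2) * y1) g4 *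
          divpow (sc (- 1) * y3) g1 * divpow y4 sg) * divpow y5 N))) * y5 ^ t))))) =
   (\<Sum>d=0..min m (rb + g1).
     sc (K * ((- 1) ^ a / fact a) * (1 / fact qa) * ((- 1) ^ b1 / fact b1) * ((1 / 2) ^ b2 / fact b2) * (1 / fact rb) *
       ((- 1 / 6) ^ g3 / fact g3) * ((1 / 2) ^ g2 / fact g2) * ((1 / 2) ^ g4 / fact g4) * ((- 1) ^ g1 / fact g1) *
       (1 / fact sg) * (1 / fact N) *
       (fact m * fact (rb + g1) * ((- 1) ^ d / fact d * (1 / fact (rb + g1 - d) * (1 / fact (m - d)))))) *
     pbw (J + a + b2 + g4 + g3 + d) (k + qa + b1 + g2) (l + (rb + g1 - d)) (m - d + sg) (N + t))"
  (is "?L = ?R")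
proof -
  let ?\<kappa> = "K * ((- 1) ^ a / fact a) * (1 / fact qa) * ((- 1) ^ b1 / fact b1) * ((1 / 2) ^ b2 / fact b2) * (1 / fact rb) *
       ((- 1 / 6) ^ g3 / fact g3) * ((1 / 2) ^ g2 / fact g2) * ((1 / 2) ^ g4 / fact g4) * ((- 1) ^ g1 / fact g1) *
       (1 / fact sg) * (1 / fact N)"
  have "?L = sc ?\<kappa> * (y1 ^ (J + a + b2 + g4 + g3) * (y2 ^ (k + qa + b1 + g2) * (y3 ^ l *
      ((y4 ^ m * y3 ^ (rb + g1)) * (y4 ^ sg * y5 ^ (N + t))))))"
    unfolding divpow_scaled unfolding divpow_def by (simp only: sort_powers mult_ac add_ac)
  also have "\<dots> = ?R"
    unfolding power_swap sum_distrib_left sum_distrib_right pbw_def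
    by (intro sum.cong refl) (simp only: sort_powers mult_ac add_ac)
  finally show ?thesis .
qed

lemma pbw_mult_pbw:
  "pbw j k l m n * pbw p q r s t =
    (\<Sum>a=0..min n q. \<Sum>(b1, b2)\<in>{(b1, b2). b1 + b2 \<le> r \<and> b1 + 2 * b2 \<le> n - a}.
      \<Sum>(g1, g2, g3, g4)\<in>{(g1, g2, g3, g4). g1 + g2 + g3 + 2 * g4 \<le> s \<and>
             g1 + 2 * g2 + 3 * g3 + g4 \<le> n - a - b1 - 2 * b2}.
      \<Sum>d=0..min m (r - b1 - b2 + g1).
        sc (reorder_coeff m n q r s a b1 b2 g1 g2 g3 g4 d) *
        pbw (j + p + a + b2 + g4 + g3 + d) (k + q - a + b1 + g2) (l + r - b1 - b2 + g1 - d)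
          (m + s - d - g1 - g2 - g3 - 2 * g4) (n + t - a - b1 - 2 * b2 - g1 - 2 * g2 - 3 * g3 - g4))"
proof -
  let ?K = "fact n * fact q * fact r * fact s :: 'f"
  have *: "y5 ^ n * (y2 ^ q * (y3 ^ r * y4 ^ s)) = sc ?K * (divpow y5 n * (divpow y2 q * divpow y3 r * divpow y4 s))"
    by (simp only: power_eq_divpow scaled_mult) (simp only: mult.assoc)
  have "pbw j k l m n * pbw p q r s t =
      y1 ^ (j + p) * (y2 ^ k * (y3 ^ l * (y4 ^ m * ((y5 ^ n * (y2 ^ q * (y3 ^ r * y4 ^ s))) * y5 ^ t))))"
    by (simp only: pbw_def sort_powers)
  also have "\<dots> = sc ?K * (y1 ^ (j + p) * (y2 ^ k * (y3 ^ l * (y4 ^ m *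
      ((divpow y5 n * (divpow y2 q * divpow y3 r * divpow y4 s)) * y5 ^ t)))))"
    unfolding * by (simp only: mult.assoc sc_left_commute[of "_ ^ _"])
  also have "\<dots> = (\<Sum>a=0..min n q. \<Sum>(b1, b2)\<in>{(b1, b2). b1 + b2 \<le> r \<and> b1 + 2 * b2 \<le> n - a}.
      \<Sum>(g1, g2, g3, g4)\<in>{(g1, g2, g3, g4). g1 + g2 + g3 + 2 * g4 \<le> s \<and>
             g1 + 2 * g2 + 3 * g3 + g4 \<le> n - a - (b1 + 2 * b2)}.
      \<Sum>d=0..min m (r - b1 - b2 + g1).
        sc (reorder_coeff m n q r s a b1 b2 g1 g2 g3 g4 d) *
        pbw (j + p + a + b2 + g4 + g3 + d) (k + (q - a) + b1 + g2) (l + (r - b1 - b2 + g1 - d))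
          (m - d + (s - g1 - g2 - g3 - 2 * g4)) (n - a - (b1 + 2 * b2) - (g1 + 2 * g2 + 3 * g3 + g4) + t))"
    unfolding divpow_reorder sum_distrib_left sum_distrib_right case_prod_unfold reorder_term
    by (intro sum.cong refl arg_cong2[where f = "(*)"] arg_cong[where f = sc] reorder_coeff_eq) auto
  \<comment> \<open>The index bounds make the truncated subtractions in the exponents agree.\<close>
  also have "\<dots> = (\<Sum>a=0..min n q. \<Sum>(b1, b2)\<in>{(b1, b2). b1 + b2 \<le> r \<and> b1 + 2 * b2 \<le> n - a}.
      \<Sum>(g1, g2, g3, g4)\<in>{(g1, g2, g3, g4). g1 + g2 + g3 + 2 * g4 \<le> s \<and>
             g1 + 2 * g2 + 3 * g3 + g4 \<le> n - a - b1 - 2 * b2}.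
      \<Sum>d=0..min m (r - b1 - b2 + g1).
        sc (reorder_coeff m n q r s a b1 b2 g1 g2 g3 g4 d) *
        pbw (j + p + a + b2 + g4 + g3 + d) (k + q - a + b1 + g2) (l + r - b1 - b2 + g1 - d)
          (m + s - d - g1 - g2 - g3 - 2 * g4) (n + t - a - b1 - 2 * b2 - g1 - 2 * g2 - 3 * g3 - g4))"
    unfolding case_prod_unfold
    by (intro sum.cong refl arg_cong2[where f = "(*)"] pbw_cong) auto
  finally show ?thesis .
qed

end

section \<open>A type for the enveloping algebra of the model\<close>

definition ground_algebra :: "('f::field, 'f) module" where
  "ground_algebra = \<lparr>carrier = UNIV, mult = (*), one = 1, zero = 0, add = (+), smult = (*)\<rparr>"

text \<open>The zero map from the Lie algebra to the ground field extends to the augmentation, which separates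
  \<open>1\<close> from \<open>0\<close>. The class \<open>ring_1\<close> requires this.\<close>

lemma uea_one_neq_zero:
  fixes scale :: "'f::field \<Rightarrow> 'l::ab_group_add \<Rightarrow> 'l"
  shows "\<one>\<^bsub>uea scale brk\<^esub> \<noteq> \<zero>\<^bsub>uea scale brk\<^esub>"
proof -
  let ?G = "ground_algebra :: ('f, 'f) module"
  have "ring ?G"
    by (rule ringI, rule abelian_groupI, simp_all add: ground_algebra_def algebra_simps monoid_def)
       (auto intro: exI[of _ "- _"] left_minus)
  then interpret G: assoc_algebra ?G
    by (rule assoc_algebra.intro) (unfold_locales, simp_all add: ground_algebra_def algebra_simps)
  have "(\<lambda>x. \<zero>\<^bsub>?G\<^esub>) \<in> lie_map scale brk ?G"
    by (simp add: lie_map_def a_minus_def)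
       (simp add: ground_algebra_def)
  then obtain f where f: "f \<in> algebra_hom (uea scale brk) ?G"
    using G.uea_universal(1) by blast
  then have "f \<in> ring_hom (uea scale brk) ?G" by (simp add: algebra_hom_def)
  then have "f \<one>\<^bsub>uea scale brk\<^esub> = 1" "f \<zero>\<^bsub>uea scale brk\<^esub> = 0"
    using ring_hom_one ring_hom_zero[OF _ ring_uea G.ring_axioms]
    by (fastforce simp: ground_algebra_def)+
  then show ?thesis by auto
qed

text \<open>A type can depend on the field, but not on the structure maps of an arbitrary Lie algebra; hence
  the restriction to the model.\<close>

typedef (overloaded) 'f n56_uea = "carrier (uea (n56_scale :: 'f::field \<Rightarrow> _) n56_brk)"
  using ring.ring_simprules(6)[OF ring_uea] by blast

setup_lifting type_definition_n56_uea

instantiation n56_uea :: (field) ring_1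
begin

lift_definition zero_n56_uea :: "'a n56_uea" is "\<zero>\<^bsub>uea n56_scale n56_brk\<^esub>"
  by (rule ring.ring_simprules[OF ring_uea])
lift_definition one_n56_uea :: "'a n56_uea" is "\<one>\<^bsub>uea n56_scale n56_brk\<^esub>"
  by (rule ring.ring_simprules[OF ring_uea])
lift_definition plus_n56_uea :: "'a n56_uea \<Rightarrow> 'a n56_uea \<Rightarrow> 'a n56_uea" is "add (uea n56_scale n56_brk)"
  by (rule ring.ring_simprules[OF ring_uea])
lift_definition times_n56_uea :: "'a n56_uea \<Rightarrow> 'a n56_uea \<Rightarrow> 'a n56_uea" is "mult (uea n56_scale n56_brk)"
  by (rule ring.ring_simprules[OF ring_uea])
lift_definition uminus_n56_uea :: "'a n56_uea \<Rightarrow> 'a n56_uea" is "a_inv (uea n56_scale n56_brk)"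
  by (rule ring.ring_simprules[OF ring_uea])
lift_definition minus_n56_uea :: "'a n56_uea \<Rightarrow> 'a n56_uea \<Rightarrow> 'a n56_uea" is "a_minus (uea n56_scale n56_brk)"
  by (rule ring.ring_simprules[OF ring_uea])

instance
proof
  interpret ring "uea (n56_scale :: 'a \<Rightarrow> _) n56_brk" by (rule ring_uea)
  fix a b c :: "'a n56_uea"
  show "a + b + c = a + (b + c)" by transfer (rule a_assoc)
  show "a + b = b + a" by transfer (rule a_comm)
  show "0 + a = a" by transfer (rule l_zero)
  show "- a + a = 0" by transfer (rule l_neg)
  show "a - b = a + - b" by transfer (rule minus_eq)
  show "a * b * c = a * (b * c)" by transfer (rule m_assoc)
  show "1 * a = a" by transfer (rule l_one)
  show "a * 1 = a" by transfer (rule r_one)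
  show "(a + b) * c = a * c + b * c" by transfer (rule l_distr)
  show "a * (b + c) = a * b + a * c" by transfer (rule r_distr)
  show "(0 :: 'a n56_uea) \<noteq> 1" by transfer (rule uea_one_neq_zero[symmetric])
qed

end

lemma uea_incl_closed: "uea_incl scale brk x \<in> carrier (uea scale brk)"
  and uea_incl_add: "uea_incl scale brk (x + y) = uea_incl scale brk x \<oplus>\<^bsub>uea scale brk\<^esub> uea_incl scale brk y"
  and uea_incl_brk: "uea_incl scale brk (brk x y) = uea_incl scale brk x \<otimes>\<^bsub>uea scale brk\<^esub> uea_incl scale brk y
      \<ominus>\<^bsub>uea scale brk\<^esub> uea_incl scale brk y \<otimes>\<^bsub>uea scale brk\<^esub> uea_incl scale brk x"
  using lie_map_uea_incl[of scale brk] unfolding lie_map_def by blast+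

lift_definition n56_incl :: "'f \<times> 'f \<times> 'f \<times> 'f \<times> 'f \<Rightarrow> 'f::field n56_uea" is "uea_incl n56_scale n56_brk"
  by (rule uea_incl_closed)

lift_definition n56_smult :: "'f::field \<Rightarrow> 'f n56_uea \<Rightarrow> 'f n56_uea" is "smult (uea n56_scale n56_brk)"
  by (rule assoc_algebra.smult_closed[OF assoc_algebra_uea])

lemma n56_incl_add: "n56_incl (u + v) = n56_incl u + n56_incl v"
  by transfer (rule uea_incl_add)

lemma n56_incl_brk: "n56_incl (n56_brk u v) = n56_incl u * n56_incl v - n56_incl v * n56_incl u"
  by transfer (rule uea_incl_brk)

lemma n56_incl_minus: "n56_incl (- u) = - n56_incl u" and n56_incl_zero: "n56_incl 0 = 0"
proof -
  show 0: "n56_incl 0 = 0" using n56_incl_add[of 0 0] by simp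
  show "n56_incl (- u) = - n56_incl u"
    using n56_incl_add[of "- u" u] by (simp add: 0 eq_neg_iff_add_eq_0)
qed

lemma n56_smult_mult: "n56_smult c x * y = n56_smult c (x * y)" "x * n56_smult c y = n56_smult c (x * y)"
  by (transfer, rule assoc_algebra.smult_mult_left[OF assoc_algebra_uea] assoc_algebra.smult_mult_right[OF assoc_algebra_uea]; assumption)+

lemma n56_smult_one_mult: "n56_smult c 1 * x = n56_smult c x" "x * n56_smult c 1 = n56_smult c x"
  by (simp_all add: n56_smult_mult)

lemma n56_central_scalars: "central_scalars (\<lambda>c :: 'f::field_char_0. n56_smult c 1)"
proof
  fix a b c :: 'f and x :: "'f n56_uea"
  show "n56_smult (a + b) 1 = n56_smult a 1 + (n56_smult b 1 :: 'f n56_uea)"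
    by transfer (intro assoc_algebra.smult_add_left[OF assoc_algebra_uea] ring.ring_simprules(6)[OF ring_uea])
  have "n56_smult a (n56_smult b 1) = (n56_smult (a * b) 1 :: 'f n56_uea)"
    by transfer (intro assoc_algebra.smult_smult[OF assoc_algebra_uea] ring.ring_simprules(6)[OF ring_uea])
  then show "n56_smult (a * b) 1 = n56_smult a 1 * (n56_smult b 1 :: 'f n56_uea)"
    by (simp only: n56_smult_one_mult(1))
  show "n56_smult 1 1 = (1 :: 'f n56_uea)"
    by transfer (intro assoc_algebra.smult_1[OF assoc_algebra_uea] ring.ring_simprules(6)[OF ring_uea])
  show "x * n56_smult c 1 = n56_smult c 1 * x"
    by (simp only: n56_smult_one_mult)
qed

lemma n56_uea_relations:
  "n56_relations (\<lambda>c :: 'f::field_char_0. n56_smult c 1)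
    (n56_incl (1, 0, 0, 0, 0)) (n56_incl (0, 1, 0, 0, 0)) (n56_incl (0, 0, 1, 0, 0))
    (n56_incl (0, 0, 0, 1, 0)) (n56_incl (0, 0, 0, 0, 1))"
proof -
  have rel: "n56_incl u * n56_incl v = n56_incl v * n56_incl u + n56_incl (n56_brk u v)" for u v :: "'f \<times> 'f \<times> 'f \<times> 'f \<times> 'f"
    by (simp add: n56_incl_brk)
  have minus: "n56_incl (- a, - b, - c, - d, - e) = - n56_incl (a, b, c, d, e :: 'f)" for a b c d e
    using n56_incl_minus[of "(a, b, c, d, e)"] by simp
  have zero: "n56_incl (0, 0, 0, 0, 0 :: 'f) = 0"
    using n56_incl_zero by (simp add: zero_prod_def)
  show ?thesis
    by (intro n56_relations.intro n56_central_scalars n56_relations_axioms.intro; subst rel;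
        simp add: n56_brk_def zero minus[of 1 0 0 0 0, simplified] minus[of 0 1 0 0 0, simplified] minus[of 0 0 1 0 0, simplified])
qed

section \<open>Transfer to an arbitrary Lie algebra with these brackets\<close>

context lie_algebra_n56
begin

definition from_model :: "'f \<times> 'f \<times> 'f \<times> 'f \<times> 'f \<Rightarrow> 'l" where
  "from_model = (\<lambda>(a1, a2, a3, a4, a5). scale a1 x1 + scale a2 x2 + scale a3 x3 + scale a4 x4 + scale a5 x5)"

lemma brk_commute: "brk x y = - brk y x"
proof -
  have "brk x y + brk y x = 0"
    using brk_self[of "x + y"] unfolding brk_add_left brk_add_right by (simp add: brk_self add.commute)
  then show ?thesis by (simp add: eq_neg_iff_add_eq_0)
qed

lemma from_model_brk: "from_model (n56_brk u v) = brk (from_model u) (from_model v)"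
proof -
  obtain a1 a2 a3 a4 a5 where u: "u = (a1, a2, a3, a4, a5)" by (metis prod.exhaust)
  obtain b1 b2 b3 b4 b5 where v: "v = (b1, b2, b3, b4, b5)" by (metis prod.exhaust)
  have "brk x1 x2 = 0" "brk x1 x3 = 0" "brk x1 x4 = 0" "brk x1 x5 = 0" "brk x2 x3 = 0" "brk x2 x4 = 0"
    "brk x3 x4 = x1" "brk x2 x5 = x1" "brk x3 x5 = x2" "brk x4 x5 = x3"
    by (simp_all add: brk_commute[of x1 x2] brk_commute[of x1 x3] brk_commute[of x1 x4] brk_commute[of x1 x5]
        brk_commute[of x2 x3] brk_commute[of x2 x4] brk_commute[of x3 x4] brk_commute[of x2 x5]
        brk_commute[of x3 x5] brk_commute[of x4 x5]
        brk_21 brk_31 brk_41 brk_51 brk_32 brk_42 brk_43 brk_52 brk_53 brk_54)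
  then show ?thesis
    by (simp add: u v from_model_def n56_brk_def brk_add_left brk_add_right brk_scale_left brk_scale_right brk_self
        brk_21 brk_31 brk_41 brk_51 brk_32 brk_42 brk_43 brk_52 brk_53 brk_54
        scale_left_distrib scale_left_diff_distrib scale_right_distrib scale_right_diff_distrib mult.commute)
qed

lemma from_model_add: "from_model (u + v) = from_model u + from_model v"
  by (cases u; cases v) (simp add: from_model_def scale_left_distrib split: prod.splits)

lemma from_model_scale: "from_model (n56_scale c u) = scale c (from_model u)"
  by (cases u) (simp add: from_model_def n56_scale_def scale_right_distrib)

text \<open>The map \<open>from_model\<close> is a homomorphism of Lie algebras; followed by the inclusion into the enveloping algebra
  it extends to a homomorphism of associative algebras.\<close>

lemma obtain_uea_hom:
  obtains F :: "'f n56_uea \<Rightarrow> ('l list \<Rightarrow>\<^sub>0 'f) set"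
  where "\<And>a. F a \<in> carrier (uea scale brk)"
    and "\<And>a b. F (a + b) = F a \<oplus>\<^bsub>uea scale brk\<^esub> F b"
    and "\<And>a b. F (a * b) = F a \<otimes>\<^bsub>uea scale brk\<^esub> F b"
    and "F 1 = \<one>\<^bsub>uea scale brk\<^esub>"
    and "\<And>c a. F (n56_smult c a) = c \<odot>\<^bsub>uea scale brk\<^esub> F a"
    and "\<And>u. F (n56_incl u) = uea_incl scale brk (from_model u)"
proof -
  let ?U = "uea scale brk" and ?M = "uea (n56_scale :: 'f \<Rightarrow> _) n56_brk"
  have "(\<lambda>u. uea_incl scale brk (from_model u)) \<in> lie_map n56_scale n56_brk ?U"
    using lie_map_uea_incl[of scale brk] by (simp add: lie_map_def from_model_add from_model_scale from_model_brk del: split_paired_All)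
  from assoc_algebra.uea_universal(1)[OF assoc_algebra_uea this]
  obtain f where f: "f \<in> algebra_hom ?M ?U" "\<forall>u. f (uea_incl n56_scale n56_brk u) = uea_incl scale brk (from_model u)"
    by (rule bexE)
  have hom: "f \<in> ring_hom ?M ?U" and smult: "\<And>c x. x \<in> carrier ?M \<Longrightarrow> f (c \<odot>\<^bsub>?M\<^esub> x) = c \<odot>\<^bsub>?U\<^esub> f x"
    using f(1) by (auto simp: algebra_hom_def)
  note [simp] = Rep_n56_uea
  show ?thesis
  proof (rule that[of "\<lambda>a. f (Rep_n56_uea a)"])
    show "f (Rep_n56_uea a) \<in> carrier ?U" for a
      by (rule ring_hom_closed[OF hom]) simp
    show "f (Rep_n56_uea (a + b)) = f (Rep_n56_uea a) \<oplus>\<^bsub>?U\<^esub> f (Rep_n56_uea b)" for a b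
      using ring_hom_add[OF hom, of "Rep_n56_uea a" "Rep_n56_uea b"] by (simp add: plus_n56_uea.rep_eq)
    show "f (Rep_n56_uea (a * b)) = f (Rep_n56_uea a) \<otimes>\<^bsub>?U\<^esub> f (Rep_n56_uea b)" for a b
      using ring_hom_mult[OF hom, of "Rep_n56_uea a" "Rep_n56_uea b"] by (simp add: times_n56_uea.rep_eq)
    show "f (Rep_n56_uea 1) = \<one>\<^bsub>?U\<^esub>"
      using ring_hom_one[OF hom] by (simp add: one_n56_uea.rep_eq)
    show "f (Rep_n56_uea (n56_smult c a)) = c \<odot>\<^bsub>?U\<^esub> f (Rep_n56_uea a)" for c a
      using smult[of "Rep_n56_uea a" c] by (simp add: n56_smult.rep_eq)
    show "f (Rep_n56_uea (n56_incl u)) = uea_incl scale brk (from_model u)" for u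
      by (simp only: n56_incl.rep_eq f(2)[THEN spec])
  qed
qed

end

theorem theorem4p14:
  fixes scale :: "'f::real_or_complex \<Rightarrow> 'l::ab_group_add \<Rightarrow> 'l"
    and brk :: "'l \<Rightarrow> 'l \<Rightarrow> 'l"
    and x1 x2 x3 x4 x5 :: 'l
    and j k l m n p q r s t :: nat
  assumes "lie_algebra_n56 scale brk x1 x2 x3 x4 x5"
  shows "let U = uea scale brk;
             \<iota> = uea_incl scale brk;
             X = ordered_monomial U (\<iota> x1) (\<iota> x2) (\<iota> x3) (\<iota> x4) (\<iota> x5)
    in X j k l m n \<otimes>\<^bsub>U\<^esub> X p q r s t =
      finsum U (\<lambda>\<alpha>.
        finsum U (\<lambda>(\<beta>\<^sub>1, \<beta>\<^sub>2).
          finsum U (\<lambda>(\<gamma>\<^sub>1, \<gamma>\<^sub>2, \<gamma>\<^sub>3, \<gamma>\<^sub>4).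
            finsum U (\<lambda>\<delta>.
              (of_nat (n choose \<alpha>) * of_nat (q choose \<alpha>)
               * of_nat (r choose (\<beta>\<^sub>1 + \<beta>\<^sub>2)) * of_nat ((n - \<alpha>) choose (\<beta>\<^sub>1 + 2 * \<beta>\<^sub>2))
               * of_nat ((\<beta>\<^sub>1 + \<beta>\<^sub>2) choose \<beta>\<^sub>1)
               * of_nat (s choose (\<gamma>\<^sub>1 + \<gamma>\<^sub>2 + \<gamma>\<^sub>3 + 2 * \<gamma>\<^sub>4))
               * of_nat ((n - \<alpha> - \<beta>\<^sub>1 - 2 * \<beta>\<^sub>2) choose (\<gamma>\<^sub>1 + 2 * \<gamma>\<^sub>2 + 3 * \<gamma>\<^sub>3 + \<gamma>\<^sub>4))
               * of_nat (m choose \<delta>) * of_nat ((r - \<beta>\<^sub>1 - \<beta>\<^sub>2 + \<gamma>\<^sub>1) choose \<delta>)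
               * fact \<alpha> * (fact (\<beta>\<^sub>1 + 2 * \<beta>\<^sub>2) / 2 ^ \<beta>\<^sub>2)
               * (fact (\<gamma>\<^sub>1 + \<gamma>\<^sub>2 + \<gamma>\<^sub>3 + 2 * \<gamma>\<^sub>4) * fact (\<gamma>\<^sub>1 + 2 * \<gamma>\<^sub>2 + 3 * \<gamma>\<^sub>3 + \<gamma>\<^sub>4)
                  / (fact 2 ^ (\<gamma>\<^sub>2 + \<gamma>\<^sub>4) * fact 3 ^ \<gamma>\<^sub>3
                     * fact \<gamma>\<^sub>4 * fact \<gamma>\<^sub>3 * fact \<gamma>\<^sub>2 * fact \<gamma>\<^sub>1))
               * fact \<delta> * (- 1) ^ (\<alpha> + \<beta>\<^sub>1 + \<gamma>\<^sub>1 + \<gamma>\<^sub>3 + \<delta>))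
              \<odot>\<^bsub>U\<^esub>
              X (j + p + \<alpha> + \<beta>\<^sub>2 + \<gamma>\<^sub>4 + \<gamma>\<^sub>3 + \<delta>)
                (k + q - \<alpha> + \<beta>\<^sub>1 + \<gamma>\<^sub>2)
                (l + r - \<beta>\<^sub>1 - \<beta>\<^sub>2 + \<gamma>\<^sub>1 - \<delta>)
                (m + s - \<delta> - \<gamma>\<^sub>1 - \<gamma>\<^sub>2 - \<gamma>\<^sub>3 - 2 * \<gamma>\<^sub>4)
                (n + t - \<alpha> - \<beta>\<^sub>1 - 2 * \<beta>\<^sub>2 - \<gamma>\<^sub>1 - 2 * \<gamma>\<^sub>2 - 3 * \<gamma>\<^sub>3 - \<gamma>\<^sub>4))
            {0..min m (r - \<beta>\<^sub>1 - \<beta>\<^sub>2 + \<gamma>\<^sub>1)})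
          {(\<gamma>\<^sub>1, \<gamma>\<^sub>2, \<gamma>\<^sub>3, \<gamma>\<^sub>4). \<gamma>\<^sub>1 + \<gamma>\<^sub>2 + \<gamma>\<^sub>3 + 2 * \<gamma>\<^sub>4 \<le> s \<and>
             \<gamma>\<^sub>1 + 2 * \<gamma>\<^sub>2 + 3 * \<gamma>\<^sub>3 + \<gamma>\<^sub>4 \<le> n - \<alpha> - \<beta>\<^sub>1 - 2 * \<beta>\<^sub>2})
        {(\<beta>\<^sub>1, \<beta>\<^sub>2). \<beta>\<^sub>1 + \<beta>\<^sub>2 \<le> r \<and> \<beta>\<^sub>1 + 2 * \<beta>\<^sub>2 \<le> n - \<alpha>})
      {0..min n q}"
proof -
  interpret L: lie_algebra_n56 scale brk x1 x2 x3 x4 x5 by (rule assms)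
  interpret U: ring "uea scale brk" by (rule ring_uea)
  let ?U = "uea scale brk" and ?i = "uea_incl scale brk"
  obtain F :: "'f n56_uea \<Rightarrow> ('l list \<Rightarrow>\<^sub>0 'f) set"
    where F_closed: "\<And>a. F a \<in> carrier ?U"
    and F_add: "\<And>a b. F (a + b) = F a \<oplus>\<^bsub>?U\<^esub> F b"
    and F_mult: "\<And>a b. F (a * b) = F a \<otimes>\<^bsub>?U\<^esub> F b"
    and F_one: "F 1 = \<one>\<^bsub>?U\<^esub>"
    and F_smult: "\<And>c a. F (n56_smult c a) = c \<odot>\<^bsub>?U\<^esub> F a"
    and F_incl: "\<And>u. F (n56_incl u) = ?i (L.from_model u)"
    by (rule L.obtain_uea_hom) (rule that)
  have F_zero: "F 0 = \<zero>\<^bsub>?U\<^esub>"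
    using F_add[of 0 0] F_closed[of 0] by simp
  have F_sum: "F (sum g S) = finsum ?U (\<lambda>i. F (g i)) S" for g and S :: "'i set"
  proof (induction S rule: infinite_finite_induct)
    case (insert x S)
    then show ?case using F_closed by (simp add: F_add)
  qed (simp_all add: F_zero U.finsum_infinite)
  have F_power: "F (a ^ n) = F a [^]\<^bsub>?U\<^esub> n" for a and n :: nat
    by (induction n) (simp_all add: F_one F_mult power_Suc2 del: power_Suc)
  let ?y1 = "n56_incl (1, 0, 0, 0, 0) :: 'f n56_uea" and ?y2 = "n56_incl (0, 1, 0, 0, 0) :: 'f n56_uea"
    and ?y3 = "n56_incl (0, 0, 1, 0, 0) :: 'f n56_uea" and ?y4 = "n56_incl (0, 0, 0, 1, 0) :: 'f n56_uea"
    and ?y5 = "n56_incl (0, 0, 0, 0, 1) :: 'f n56_uea"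
  interpret N: n56_relations "\<lambda>c :: 'f. n56_smult c 1" ?y1 ?y2 ?y3 ?y4 ?y5
    by (rule n56_uea_relations)
  have F_pbw: "F (N.pbw a b c d e) = ordered_monomial ?U (?i x1) (?i x2) (?i x3) (?i x4) (?i x5) a b c d e" for a b c d e
    by (simp add: N.pbw_def ordered_monomial_def F_mult F_power F_incl L.from_model_def)
  show ?thesis
    using arg_cong[OF N.pbw_mult_pbw, of F j k l m n p q r s t]
    unfolding F_mult F_sum F_pbw n56_smult_one_mult F_smult case_prod_unfold Let_def reorder_coeff_def .
qed

end
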